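(* Let $N,k$ be integers, and let $\mathscr{C}$ be the class of all graphs that admit a $2$-cosplit of size at most $N$ and height at most $k$. Then there exist an integer $d$, a coloring procedure $\mathsf C$ (assigning to each $G\in\mathscr{C}$ a coloring $\mathsf C(G)$ of $G$ using finitely many unary predicates), a class $\mathscr{D}$ of $d$-degenerate colored graphs, and two first-order formulas $\varphi,\psi$, such that: (i) given a graph $G$ and a $2$-cosplit of $G$ of size at most $N$ and height at most $k$, the procedure $\mathsf C$ computes the coloring $\mathsf C(G)$ in polynomial time; and (ii) the pair $(\varphi,\psi)$ is a simple equivalence of the classes $\mathsf C(\mathscr{C})=\{\mathsf C(G):G\in\mathscr{C}\}$ and $\mathscr{D}$.
   Context: A coloring of a graph is obtained by adding interpretations of unary predicates $P_1,P_2,\dots$ (arbitrary vertex subsets). For a first-order formula $\eta(x,y)$ over the signature of colored graphs (edge relation plus unary predicates), $\mathsf I_\eta$ maps a colored graph $G$ to the colored graph with the same vertex set and same unary predicates, in which distinct $u,v$ are adjacent iff $G\models\eta(u,v)\vee\eta(v,u)$. A simple equivalence of classes $\mathscr{C}',\mathscr{D}$ of colored graphs is a pair $(\varphi,\psi)$ of first-order formulas such that $\mathsf I_\varphi$ is a bijection from $\mathscr{C}'$ to $\mathscr{D}$ whose inverse is $\mathsf I_\psi$. $2$-cosplit: a partition $\mathscr{P}$ of $V(G)$ such that $G[A]$ is a cograph for every $A\in\mathscr{P}$ and the semi-induced bipartite graph $G[A,B]$ (sides $A,B$, edges of $G$ between them) is a bi-cograph for distinct $A,B\in\mathscr{P}$;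 size $|\mathscr{P}|$; height at most $h$ if all these are defined by cotrees / bi-cotrees of height at most $h$. A cotree of height $\le h$ is a rooted tree of height $\le h$ whose leaves are the vertices with $f:I(T)\to\{0,1\}$, leaves $u\ne v$ adjacent iff $f(u\wedge v)=1$ ($u\wedge v$ lowest common ancestor); a bi-cotree additionally colors leaves by their side in $\{1,2\}$ and uses $f:I(T)\times[2]\times[2]\to\{0,1\}$ symmetric in the last two arguments with $f(x,1,1)=f(x,2,2)=0$, $u,v$ adjacent iff $f(u\wedge v,c(u),c(v))=1$. *)

theory Defs
  imports "HOL-Library.Disjoint_Sets" "HOL-Computational_Algebra.Polynomial"
begin

section \<open>Graphs and colored graphs\<close>

record 'v graph =
  verts :: "'v set"
  adj :: "'v \<Rightarrow> 'v \<Rightarrow> bool"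

text \<open>The unary predicates are indexed by all natural numbers; a coloring with \<open>m\<close> predicates
  leaves the predicates of index at least \<open>m\<close> empty.\<close>

record 'v cgraph = "'v graph" +
  upred :: "nat \<Rightarrow> 'v set"

definition simple_graph :: "('v, 'z) graph_scheme \<Rightarrow> bool" where
  "simple_graph G \<longleftrightarrow> finite (verts G) \<and>
     (\<forall>u v. adj G u v \<longrightarrow> u \<in> verts G \<and> v \<in> verts G \<and> u \<noteq> v \<and> adj G v u)"

definition coloring :: "nat \<Rightarrow> ('v, 'z) graph_scheme \<Rightarrow> (nat \<Rightarrow> 'v set) \<Rightarrow> bool" where
  "coloring m G \<kappa> \<longleftrightarrow> (\<forall>i. \<kappa> i \<subseteq> verts G) \<and> (\<forall>i\<ge>m. \<kappa> i = {})"

definition colored :: "('v, 'z) graph_scheme \<Rightarrow> (nat \<Rightarrow> 'v set) \<Rightarrow> 'v cgraph" where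
  "colored G \<kappa> = \<lparr>verts = verts G, adj = adj G, upred = \<kappa>\<rparr>"

definition colored_graph :: "nat \<Rightarrow> 'v cgraph \<Rightarrow> bool" where
  "colored_graph m G \<longleftrightarrow> simple_graph G \<and> coloring m G (upred G)"

definition degenerate :: "nat \<Rightarrow> ('v, 'z) graph_scheme \<Rightarrow> bool" where
  "degenerate d G \<longleftrightarrow>
     (\<forall>X. X \<subseteq> verts G \<and> X \<noteq> {} \<longrightarrow> (\<exists>v\<in>X. card {u \<in> X. adj G v u} \<le> d))"

definition induced :: "('v, 'z) graph_scheme \<Rightarrow> 'v set \<Rightarrow> 'v graph" where
  "induced G A = \<lparr>verts = A, adj = (\<lambda>u v. u \<in> A \<and> v \<in> A \<and> adj G u v)\<rparr>"

definition semi_induced :: "('v, 'z) graph_scheme \<Rightarrow> 'v set \<Rightarrow> 'v set \<Rightarrow> 'v graph" where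
  "semi_induced G A B = \<lparr>verts = A \<union> B,
     adj = (\<lambda>u v. (u \<in> A \<and> v \<in> B \<or> u \<in> B \<and> v \<in> A) \<and> adj G u v)\<rparr>"


section \<open>First-order formulas and simple equivalences\<close>

datatype fm =
    Equal nat nat
  | Edge nat nat
  | UPred nat nat \<comment> \<open>\<open>UPred i x\<close>: the \<open>i\<close>-th unary predicate holds at variable \<open>x\<close>\<close>
  | Neg fm
  | Conj fm fm
  | Exi nat fm

fun fv :: "fm \<Rightarrow> nat set" where
  "fv (Equal x y) = {x, y}"
| "fv (Edge x y) = {x, y}"
| "fv (UPred i x) = {x}"
| "fv (Neg \<eta>) = fv \<eta>"
| "fv (Conj \<eta> \<theta>) = fv \<eta> \<union> fv \<theta>"
| "fv (Exi x \<eta>) = fv \<eta> - {x}"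

fun sat :: "'v cgraph \<Rightarrow> (nat \<Rightarrow> 'v) \<Rightarrow> fm \<Rightarrow> bool" where
  "sat G \<sigma> (Equal x y) \<longleftrightarrow> \<sigma> x = \<sigma> y"
| "sat G \<sigma> (Edge x y) \<longleftrightarrow> adj G (\<sigma> x) (\<sigma> y)"
| "sat G \<sigma> (UPred i x) \<longleftrightarrow> \<sigma> x \<in> upred G i"
| "sat G \<sigma> (Neg \<eta>) \<longleftrightarrow> \<not> sat G \<sigma> \<eta>"
| "sat G \<sigma> (Conj \<eta> \<theta>) \<longleftrightarrow> sat G \<sigma> \<eta> \<and> sat G \<sigma> \<theta>"
| "sat G \<sigma> (Exi x \<eta>) \<longleftrightarrow> (\<exists>v\<in>verts G. sat G (\<sigma>(x := v)) \<eta>)"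

text \<open>The variables \<open>0\<close> and \<open>1\<close> play the roles of \<open>x\<close> and \<open>y\<close> in a formula \<open>\<eta>(x,y)\<close>;
  the values of all other variables are irrelevant.\<close>

definition binary_fm :: "fm \<Rightarrow> bool" where
  "binary_fm \<eta> \<longleftrightarrow> fv \<eta> \<subseteq> {0, 1}"

definition holds2 :: "'v cgraph \<Rightarrow> fm \<Rightarrow> 'v \<Rightarrow> 'v \<Rightarrow> bool" where
  "holds2 G \<eta> u v \<longleftrightarrow> sat G (\<lambda>x. if x = 0 then u else v) \<eta>"

definition interp :: "fm \<Rightarrow> 'v cgraph \<Rightarrow> 'v cgraph" where
  "interp \<eta> G = G\<lparr>adj := (\<lambda>u v. u \<in> verts G \<and> v \<in> verts G \<and> u \<noteq> v \<and>
                             (holds2 G \<eta> u v \<or> holds2 G \<eta> v u))\<rparr>"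

definition simple_equivalence ::
  "fm \<Rightarrow> fm \<Rightarrow> 'v cgraph set \<Rightarrow> 'v cgraph set \<Rightarrow> bool" where
  "simple_equivalence \<phi> \<psi> C' D \<longleftrightarrow> binary_fm \<phi> \<and> binary_fm \<psi> \<and>
     bij_betw (interp \<phi>) C' D \<and> (\<forall>H\<in>D. interp \<psi> H = inv_into C' (interp \<phi>) H)"


section \<open>Cotrees, bi-cotrees and 2-cosplits\<close>

text \<open>The labelling of the internal nodes is stored in the nodes; the order of the children
  is immaterial.\<close>

datatype ('v, 'l) tree = Leaf 'v | Node 'l "('v, 'l) tree list"

fun leaves :: "('v, 'l) tree \<Rightarrow> 'v list" where
  "leaves (Leaf v) = [v]"
| "leaves (Node l ts) = concat (map leaves ts)"

fun subtrees :: "('v, 'l) tree \<Rightarrow> ('v, 'l) tree set" where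
  "subtrees (Leaf v) = {Leaf v}"
| "subtrees (Node l ts) = insert (Node l ts) (\<Union>t\<in>set ts. subtrees t)"

text \<open>The height is the maximum number of edges on a path from the root to a leaf.\<close>

fun height :: "('v, 'l) tree \<Rightarrow> nat" where
  "height (Leaf v) = 0"
| "height (Node l ts) = Suc (Max (height ` set ts))"

definition tree_on :: "('v, 'l) tree \<Rightarrow> 'v set \<Rightarrow> bool" where
  "tree_on T A \<longleftrightarrow> distinct (leaves T) \<and> set (leaves T) = A \<and>
     (\<forall>l. Node l [] \<notin> subtrees T)"

text \<open>A node is identified with the subtree rooted at it, which is unambiguous for internal
  nodes and leaves alike as soon as the leaves are distinct and every internal node has a child.\<close>

definition is_lca :: "('v, 'l) tree \<Rightarrow> 'v \<Rightarrow> 'v \<Rightarrow> ('v, 'l) tree \<Rightarrow> bool" where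
  "is_lca T u v s \<longleftrightarrow> s \<in> subtrees T \<and> {u, v} \<subseteq> set (leaves s) \<and>
     (\<forall>s'\<in>subtrees s. {u, v} \<subseteq> set (leaves s') \<longrightarrow> s' = s)"

definition cotree :: "('v, bool) tree \<Rightarrow> 'v graph \<Rightarrow> bool" where
  "cotree T H \<longleftrightarrow> tree_on T (verts H) \<and>
     (\<forall>u\<in>verts H. \<forall>v\<in>verts H. u \<noteq> v \<longrightarrow>
        (adj H u v \<longleftrightarrow> (\<exists>f ts. is_lca T u v (Node f ts) \<and> f)))"

datatype side = Side1 | Side2

definition bicotree ::
  "('v, side \<Rightarrow> side \<Rightarrow> bool) tree \<Rightarrow> ('v \<Rightarrow> side) \<Rightarrow> 'v graph \<Rightarrow> bool" where
  "bicotree T c H \<longleftrightarrow> tree_on T (verts H) \<and>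
     (\<forall>f ts. Node f ts \<in> subtrees T \<longrightarrow>
        (\<forall>i j. f i j = f j i) \<and> \<not> f Side1 Side1 \<and> \<not> f Side2 Side2) \<and>
     (\<forall>u\<in>verts H. \<forall>v\<in>verts H. u \<noteq> v \<longrightarrow>
        (adj H u v \<longleftrightarrow> (\<exists>f ts. is_lca T u v (Node f ts) \<and> f (c u) (c v))))"

definition sides :: "'v set \<Rightarrow> 'v \<Rightarrow> side" where
  "sides A v = (if v \<in> A then Side1 else Side2)"

definition cograph :: "'v graph \<Rightarrow> bool" where
  "cograph H \<longleftrightarrow> (\<exists>T. cotree T H)"

definition bicograph :: "('v \<Rightarrow> side) \<Rightarrow> 'v graph \<Rightarrow> bool" where
  "bicograph c H \<longleftrightarrow> (\<exists>T. bicotree T c H)"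

definition two_cosplit :: "('v, 'z) graph_scheme \<Rightarrow> 'v set set \<Rightarrow> bool" where
  "two_cosplit G P \<longleftrightarrow> partition_on (verts G) P \<and>
     (\<forall>A\<in>P. cograph (induced G A)) \<and>
     (\<forall>A\<in>P. \<forall>B\<in>P. A \<noteq> B \<longrightarrow> bicograph (sides A) (semi_induced G A B))"

definition cosplit_height_le :: "('v, 'z) graph_scheme \<Rightarrow> 'v set set \<Rightarrow> nat \<Rightarrow> bool" where
  "cosplit_height_le G P h \<longleftrightarrow>
     (\<forall>A\<in>P. \<exists>T. cotree T (induced G A) \<and> height T \<le> h) \<and>
     (\<forall>A\<in>P. \<forall>B\<in>P. A \<noteq> B \<longrightarrow>
        (\<exists>T. bicotree T (sides A) (semi_induced G A B) \<and> height T \<le> h))"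

definition bounded_cosplit :: "nat \<Rightarrow> nat \<Rightarrow> ('v, 'z) graph_scheme \<Rightarrow> 'v set set \<Rightarrow> bool" where
  "bounded_cosplit N k G P \<longleftrightarrow> two_cosplit G P \<and> card P \<le> N \<and> cosplit_height_le G P k"

definition cosplit_class :: "nat \<Rightarrow> nat \<Rightarrow> 'v graph set" where
  "cosplit_class N k = {G. simple_graph G \<and> (\<exists>P. bounded_cosplit N k G P)}"


section \<open>Polynomial-time computation\<close>

text \<open>Random access machines with structured control. The memory consists of arrays of
  natural numbers, the name of an array being fixed in the program text. Every elementary
  command and every test costs one step. The only arithmetic operations are addition and
  (truncated) subtraction, so that a run of \<open>t\<close> steps produces only numbers and addresses
  of bit length \<open>O(t)\<close> plus that of the input; by the usual simulation, polynomial time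
  here is polynomial time on Turing machines. (This would fail with multiplication at
  unit cost.)\<close>

datatype expr =
    Const nat
  | Read nat expr \<comment> \<open>\<open>Read a e\<close>: entry of array \<open>a\<close> at index \<open>e\<close>\<close>
  | Plus expr expr
  | Minus expr expr

datatype prog =
    Skip
  | Write nat expr expr \<comment> \<open>\<open>Write a e e'\<close>: store \<open>e'\<close> in array \<open>a\<close> at index \<open>e\<close>\<close>
  | Seq prog prog
  | Branch expr prog prog \<comment> \<open>first branch iff the expression is nonzero\<close>
  | Loop expr prog \<comment> \<open>repeat while the expression is nonzero\<close>

type_synonym store = "nat \<Rightarrow> nat \<Rightarrow> nat"

fun eval :: "store \<Rightarrow> expr \<Rightarrow> nat" where
  "eval s (Const n) = n"
| "eval s (Read a e) = s a (eval s e)"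
| "eval s (Plus e e') = eval s e + eval s e'"
| "eval s (Minus e e') = eval s e - eval s e'"

text \<open>\<open>exec c s t s'\<close>: started in \<open>s\<close>, the program \<open>c\<close> halts after \<open>t\<close> steps in \<open>s'\<close>.\<close>

inductive exec :: "prog \<Rightarrow> store \<Rightarrow> nat \<Rightarrow> store \<Rightarrow> bool" where
  Skip: "exec Skip s 1 s"
| Write: "exec (Write a e e') s 1 (s(a := (s a)(eval s e := eval s e')))"
| Seq: "exec c s t s' \<Longrightarrow> exec c' s' t' s'' \<Longrightarrow> exec (Seq c c') s (t + t') s''"
| BranchT: "eval s e \<noteq> 0 \<Longrightarrow> exec c s t s' \<Longrightarrow> exec (Branch e c c') s (1 + t) s'"
| BranchF: "eval s e = 0 \<Longrightarrow> exec c' s t s' \<Longrightarrow> exec (Branch e c c') s (1 + t) s'"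
| LoopF: "eval s e = 0 \<Longrightarrow> exec (Loop e c) s 1 s"
| LoopT: "eval s e \<noteq> 0 \<Longrightarrow> exec c s t s' \<Longrightarrow> exec (Loop e c) s' t' s'' \<Longrightarrow>
            exec (Loop e c) s (1 + t + t') s''"

text \<open>A graph with \<open>n\<close> vertices and a partition of its vertices are presented to the machine
  as follows, the vertices being numbered in increasing order: array \<open>0\<close> holds \<open>n\<close>, array
  \<open>1\<close> the adjacency matrix and array \<open>2\<close> the matrix of the relation of lying in the same part,
  both row by row. All other entries are \<open>0\<close>.\<close>

definition input_store :: "nat graph \<Rightarrow> nat set set \<Rightarrow> store" where
  "input_store G P a x =
     (let n = card (verts G); vs = sorted_list_of_set (verts G);
          u = vs ! (x div n); v = vs ! (x mod n)
      in if a = 0 \<and> x = 0 then n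
         else if a = 1 \<and> x < n * n then of_bool (adj G u v)
         else if a = 2 \<and> x < n * n then of_bool (\<exists>A\<in>P. u \<in> A \<and> v \<in> A)
         else 0)"

text \<open>The coloring is returned in array \<open>3\<close>, as an \<open>m\<close> times \<open>n\<close> incidence matrix.\<close>

definition output_coloring :: "nat \<Rightarrow> nat graph \<Rightarrow> store \<Rightarrow> (nat \<Rightarrow> nat set) \<Rightarrow> bool" where
  "output_coloring m G s \<kappa> \<longleftrightarrow>
     (let n = card (verts G); vs = sorted_list_of_set (verts G)
      in \<forall>i<m. \<forall>j<n. s 3 (i * n + j) = of_bool (vs ! j \<in> \<kappa> i))"

text \<open>A coloring procedure \<open>\<kappa>\<close> receives a graph together with one of its 2-cosplits; its value
  may depend on the 2-cosplit. The inputs are those in \<open>I\<close>.\<close>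

definition poly_time_coloring ::
  "(nat graph \<times> nat set set) set \<Rightarrow> nat \<Rightarrow> (nat graph \<Rightarrow> nat set set \<Rightarrow> nat \<Rightarrow> nat set) \<Rightarrow> bool"
where
  "poly_time_coloring I m \<kappa> \<longleftrightarrow>
     (\<exists>(c :: prog) (p :: nat poly). \<forall>(G, P)\<in>I. \<exists>t s.
        exec c (input_store G P) t s \<and> t \<le> poly p (card (verts G)) \<and>
        output_coloring m G s (\<kappa> G P))"

end

theory Submission
  imports Defs "HOL-Library.Countable"
begin

text \<open>
  Fix two parts \<open>A\<close> and \<open>B\<close> (possibly equal) and consider only the pairs between them. Starting from
  the trivial equivalence, split every class alternately into its connected components with respect
  to edges and to non-edges. Each level of a (bi-)cotree is used up by two such steps, so \<open>2k\<close>
  steps separate all pairs, and adjacency of a pair is the parity of the step that separates it.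
  As there are no long induced paths, components are connected by paths of bounded length, so these
  equivalences are first-order definable.

  The sparse graph joins every vertex of \<open>A\<close> to the least element of \<open>B\<close> in its class, for all pairs
  of parts and all levels, and vice versa. Its edges have an orientation with bounded outdegree. Since
  edges between \<open>A\<close> and \<open>B\<close> only concern the pair \<open>A, B\<close>, different pairs of parts do not interfere.
  The colors tell from which level on a vertex is such a representative, and from which level on
  its representatives are; this suffices to recover the equivalences, hence the graph.

  The colors are first-order definable from the graph, the partition and the order of the vertices,
  and first-order queries are decided by nested loops over the vertices.
\<close>

section \<open>Separating vertices by bounded-length paths\<close>

text \<open>The splitting is therefore defined from adjacency alone. The label of a node is unknown
  too, so both kinds of components are taken for each level. The bound on paths must also serve
  disjoint \<open>A\<close> and \<open>B\<close>, where only vertices at odd distance on a path form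
  a relevant pair; this makes 7 vertices the critical length. Walks then shorten to at most 5 steps,
  and three squarings reach \<open>2 ^ 3\<close> steps.

  The obstacle on the way back is that an edge of the sparse graph does not show which level created
  it. The levels are nested, so a vertex that represents its class at some level does so at all
  deeper ones. An edge hence certifies equivalence at the first level at which one of its ends is a
  representative, and colors settle the deeper levels. The vertex order enters only through the
  choice of representatives; the colors record this choice, so the formulas can do without the
  order.\<close>

definition cross :: "'v set \<Rightarrow> 'v set \<Rightarrow> 'v \<Rightarrow> 'v \<Rightarrow> bool" where
  "cross A B u v \<longleftrightarrow> u \<noteq> v \<and> (u \<in> A \<and> v \<in> B \<or> u \<in> B \<and> v \<in> A)"

lemma cross_sym: "cross A B u v \<Longrightarrow> cross A B v u"
  by (auto simp: cross_def)

lemma cross_swap: "cross A B = cross B A"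
  by (auto simp: cross_def fun_eq_iff)

text \<open>What remains of a tree of height at most \<open>h\<close> once the tree is forgotten:
  \<open>f\<close> names the child of the root that contains a vertex, \<open>b\<close> is the label
  of the root, and only pairs in \<open>X\<close> are constrained. With
  \<open>X = cross A B\<close>, cotrees (\<open>A = B\<close>) and bi-cotrees (disjoint sides) are
  treated alike.\<close>

inductive layered :: "('v \<Rightarrow> 'v \<Rightarrow> bool) \<Rightarrow> ('v \<Rightarrow> 'v \<Rightarrow> bool) \<Rightarrow> nat \<Rightarrow> 'v set \<Rightarrow> bool"
  for X R where
  layered_0: "\<forall>u\<in>W. \<forall>v\<in>W. \<not> X u v \<Longrightarrow> layered X R 0 W"
| layered_Suc: "\<forall>u\<in>W. \<forall>v\<in>W. X u v \<and> f u \<noteq> f v \<longrightarrow> R u v = b \<Longrightarrow>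
    \<forall>c. layered X R h {u \<in> W. f u = (c :: nat)} \<Longrightarrow> layered X R (Suc h) W"

lemma layered_mono: "layered X R h W \<Longrightarrow> W' \<subseteq> W \<Longrightarrow> layered X R h W'"
proof (induction arbitrary: W' rule: layered.induct)
  case (layered_0 W)
  then show ?case by (intro layered.layered_0) blast
next
  case (layered_Suc W f b h)
  have "layered X R h {u \<in> W'. f u = c}" for c
  proof -
    have "{u \<in> W'. f u = c} \<subseteq> {u \<in> W. f u = c}" using layered_Suc.prems by blast
    then show ?thesis using layered_Suc.IH by simp
  qed
  moreover have "\<forall>u\<in>W'. \<forall>v\<in>W'. X u v \<and> f u \<noteq> f v \<longrightarrow> R u v = b"
    using layered_Suc.hyps layered_Suc.prems by (meson subsetD)
  ultimately show ?case by (intro layered.layered_Suc[where f = f and b = b]) simp_all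
qed

lemma layered_no_cross: "\<forall>u\<in>W. \<forall>v\<in>W. \<not> X u v \<Longrightarrow> layered X R h W"
proof (induction h arbitrary: W)
  case 0
  then show ?case by (rule layered.layered_0)
next
  case (Suc h)
  then show ?case
    by (intro layered.layered_Suc[where f = "\<lambda>_. 0" and b = True]) auto
qed

text \<open>The six pairs are all those at odd distance at least 3 on the path, and they form a
  spanning tree on its 7 vertices (with 6 vertices such pairs do not connect the path). So either
  the whole path lies in one child, or the root separates one of these pairs. In the latter case its
  label is \<open>b\<close>, since otherwise no step of the path could leave a child. Odd distance
  makes the pair cross when the sides are disjoint.\<close>

lemma layered_chord:
  assumes "layered (cross A B) R h W" and "A = B \<or> A \<inter> B = {}"
    and "{x0, x1, x2, x3, x4, x5, x6} \<subseteq> W"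
    and "cross A B x0 x1" "cross A B x1 x2" "cross A B x2 x3"
        "cross A B x3 x4" "cross A B x4 x5" "cross A B x5 x6"
    and "R x0 x1 = b" "R x1 x2 = b" "R x2 x3 = b" "R x3 x4 = b" "R x4 x5 = b" "R x5 x6 = b"
  shows "\<exists>(x, y) \<in> {(x0, x3), (x1, x4), (x2, x5), (x3, x6), (x0, x5), (x1, x6)}.
           cross A B x y \<and> R x y = b"
  using assms
proof (induction rule: layered.induct)
  case (layered_0 W)
  have "x0 \<in> W" "x1 \<in> W" using layered_0.prems(2) by simp_all
  then show ?case using layered_0.hyps layered_0.prems(3) by simp
next
  case (layered_Suc W f b' h)
  note W = layered_Suc.prems(2) and X = layered_Suc.prems(3-8) and b = layered_Suc.prems(9-14)
  let ?P = "{(x0, x3), (x1, x4), (x2, x5), (x3, x6), (x0, x5), (x1, x6)}"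
  show ?case
  proof (cases "\<exists>(x, y) \<in> ?P. f x \<noteq> f y")
    case False
    then have "{x0, x1, x2, x3, x4, x5, x6} \<subseteq> {u \<in> W. f u = f x0}"
      using W by simp
    with layered_Suc.IH layered_Suc.prems(1) X b show ?thesis by simp
  next
    case True
    then obtain x y where xy: "(x, y) \<in> ?P" "f x \<noteq> f y" by blast
    then have cr: "cross A B x y"
      using X layered_Suc.prems(1) unfolding cross_def by (elim insertE) auto
    have V: "x \<in> W" "y \<in> W" using xy(1) W by auto
    have "b' = b"
    proof (rule ccontr)
      assume "b' \<noteq> b"
      then have "f u = f v" if "cross A B u v" "R u v = b" "u \<in> W" "v \<in> W" for u v
        using that layered_Suc.hyps(1) by blast
      from this[OF X(1) b(1)] this[OF X(2) b(2)] this[OF X(3) b(3)] this[OF X(4) b(4)]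
        this[OF X(5) b(5)] this[OF X(6) b(6)] show False using W xy by auto
    qed
    then have "R x y = b" using cr xy(2) V layered_Suc.hyps(1) by blast
    with cr show ?thesis using xy(1) by (intro bexI[of _ "(x, y)"]) simp_all
  qed
qed

section \<open>Bounded walks by repeated squaring\<close>

definition dbl :: "'v set \<Rightarrow> ('v \<Rightarrow> 'v \<Rightarrow> bool) \<Rightarrow> 'v \<Rightarrow> 'v \<Rightarrow> bool" where
  "dbl V S u v \<longleftrightarrow> (\<exists>z\<in>V. S u z \<and> S z v)"

lemma relpowp_Suc_left: "(F ^^ Suc n) u v \<longleftrightarrow> (\<exists>x. F u x \<and> (F ^^ n) x v)"
  by (meson relpowp_Suc_E2 relpowp_Suc_I2)

text \<open>Every 6 consecutive steps have a chord over 3 or 5 of them, which shortens the walk by 2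
  or 4.\<close>

lemma relpowp_shrink:
  assumes chord: "\<And>x0 x1 x2 x3 x4 x5 x6. F x0 x1 \<Longrightarrow> F x1 x2 \<Longrightarrow> F x2 x3 \<Longrightarrow> F x3 x4 \<Longrightarrow>
      F x4 x5 \<Longrightarrow> F x5 x6 \<Longrightarrow> F x0 x3 \<or> F x1 x4 \<or> F x2 x5 \<or> F x3 x6 \<or> F x0 x5 \<or> F x1 x6"
    and "F\<^sup>*\<^sup>* u v"
  shows "\<exists>n\<le>5. (F ^^ n) u v"
proof -
  have "\<exists>j\<le>5. (F ^^ j) u v" if "(F ^^ n) u v" for n
    using that
  proof (induction n rule: less_induct)
    case (less n)
    show ?case
    proof (cases "n \<le> 5")
      case True
      then show ?thesis using less.prems by blast
    next
      case False
      then obtain m where n: "n = Suc (Suc (Suc (Suc (Suc (Suc m)))))"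
        using that[of "n - 6"] by auto
      obtain x1 x2 x3 x4 x5 x6 where F: "F u x1" "F x1 x2" "F x2 x3" "F x3 x4" "F x4 x5" "F x5 x6"
        and rest: "(F ^^ m) x6 v"
        using less.prems unfolding n relpowp_Suc_left by blast
      have "(F ^^ Suc (Suc m)) u v \<or> (F ^^ Suc (Suc (Suc (Suc m)))) u v"
        using chord[OF F] F rest unfolding relpowp_Suc_left by blast
      then show ?thesis using less.IH[of "Suc (Suc m)"] less.IH[of "Suc (Suc (Suc (Suc m)))"]
        unfolding n by auto
    qed
  qed
  then show ?thesis using assms(2) by (auto simp: rtranclp_power)
qed

text \<open>Each application of \<open>dbl\<close> doubles the length at the price of a single
  quantifier; the reflexive base relation turns exact lengths into upper bounds.\<close>

lemma dbl_funpow: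
  assumes F: "\<And>u v. F u v \<Longrightarrow> u \<in> V \<and> v \<in> V" and "u \<in> V" "v \<in> V"
  shows "(dbl V ^^ j) (\<lambda>u v. u = v \<or> F u v) u v \<longleftrightarrow> (\<exists>n\<le>2 ^ j. (F ^^ n) u v)"
  using assms(2,3)
proof (induction j arbitrary: u v)
  case 0
  have "(\<exists>n\<le>1. (F ^^ n) u v) \<longleftrightarrow> (F ^^ 0) u v \<or> (F ^^ Suc 0) u v"
    by (metis One_nat_def le_Suc_eq le_zero_eq order_refl)
  then show ?case by auto
next
  case (Suc j)
  have mid: "w \<in> V" if "(F ^^ n) u w" "u \<in> V" for n u w
    using that by (cases n) (auto dest: F)
  have "(dbl V ^^ Suc j) (\<lambda>u v. u = v \<or> F u v) u v \<longleftrightarrow>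
      (\<exists>z\<in>V. (\<exists>n\<le>2 ^ j. (F ^^ n) u z) \<and> (\<exists>n\<le>2 ^ j. (F ^^ n) z v))"
    using Suc by (simp add: dbl_def[of V "(dbl V ^^ j) _"])
  also have "\<dots> \<longleftrightarrow> (\<exists>n\<le>2 ^ Suc j. (F ^^ n) u v)"
  proof
    assume "\<exists>z\<in>V. (\<exists>n\<le>2 ^ j. (F ^^ n) u z) \<and> (\<exists>n\<le>2 ^ j. (F ^^ n) z v)"
    then obtain z n n' where "n \<le> 2 ^ j" "(F ^^ n) u z" "n' \<le> 2 ^ j" "(F ^^ n') z v" by blast
    then show "\<exists>n\<le>2 ^ Suc j. (F ^^ n) u v"
      by (intro exI[of _ "n + n'"]) (auto simp: relpowp_add)
  next
    assume "\<exists>n\<le>2 ^ Suc j. (F ^^ n) u v"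
    then obtain n where n: "n \<le> 2 ^ Suc j" "(F ^^ n) u v" by blast
    define a where "a = min n (2 ^ j)"
    have "n = a + (n - a)" "a \<le> 2 ^ j" "n - a \<le> 2 ^ j" using n(1) by (auto simp: a_def)
    moreover from this n(2) obtain z where "(F ^^ a) u z" "(F ^^ (n - a)) z v"
      by (metis relcomppE relpowp_add)
    ultimately show "\<exists>z\<in>V. (\<exists>n\<le>2 ^ j. (F ^^ n) u z) \<and> (\<exists>n\<le>2 ^ j. (F ^^ n) z v)"
      using mid Suc.prems by blast
  qed
  finally show ?case .
qed

text \<open>Even steps connect along edges, odd steps along non-edges. Three doublings give walks of
  length at most 8, which keeps the relation first-order; that they reach the full closure under the
  layering assumption is \<open>E_Suc\<close>.\<close>

primrec sep :: "'v set \<Rightarrow> ('v \<Rightarrow> 'v \<Rightarrow> bool) \<Rightarrow> 'v set \<Rightarrow> 'v set \<Rightarrow> nat \<Rightarrow> 'v \<Rightarrow> 'v \<Rightarrow> bool" where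
  "sep V R A B 0 = (\<lambda>u v. True)"
| "sep V R A B (Suc i) =
     (dbl V ^^ 3) (\<lambda>u v. u = v \<or> sep V R A B i u v \<and> cross A B u v \<and> R u v = even i)"

lemma sep_swap: "sep V R A B i = sep V R B A i"
  by (induction i) (simp_all add: cross_swap)

declare sep.simps(2)[simp del]

section \<open>Alternating components for one pair of parts\<close>

locale layered_pair =
  fixes V :: "'v set" and R A B k
  assumes subset: "A \<subseteq> V" "B \<subseteq> V"
    and disj: "A = B \<or> A \<inter> B = {}"
    and R_sym: "R u v = R v u"
    and layered: "layered (cross A B) R k V"
begin

abbreviation "E \<equiv> sep V R A B"

definition "F i u v \<longleftrightarrow> E i u v \<and> cross A B u v \<and> R u v = even i"

lemma F_V: "F i u v \<Longrightarrow> u \<in> V \<and> v \<in> V"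
  using subset by (auto simp: F_def cross_def)

text \<open>Transitivity of level \<open>i\<close> is a premise because it is established only in
  the induction of \<open>E_equiv\<close>, which uses this lemma. It puts the ends of a chord into
  one class of level \<open>i\<close>, so that the chord is again an \<open>F i\<close>
  step.\<close>

lemma E_Suc_aux:
  assumes trans: "\<And>x y z. E i x y \<Longrightarrow> E i y z \<Longrightarrow> x \<in> V \<Longrightarrow> y \<in> V \<Longrightarrow> z \<in> V \<Longrightarrow> E i x z"
    and "u \<in> V" "v \<in> V"
  shows "E (Suc i) u v \<longleftrightarrow> (F i)\<^sup>*\<^sup>* u v"
proof -
  have chord: "F i x0 x3 \<or> F i x1 x4 \<or> F i x2 x5 \<or> F i x3 x6 \<or> F i x0 x5 \<or> F i x1 x6"
    if "F i x0 x1" "F i x1 x2" "F i x2 x3" "F i x3 x4" "F i x4 x5" "F i x5 x6"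
    for x0 x1 x2 x3 x4 x5 x6
  proof -
    note V = that[THEN F_V]
    have E: "E i x y" "E i y z \<Longrightarrow> z \<in> V \<Longrightarrow> E i x z" if "F i x y" for x y z
      using that F_V[OF that] trans[of x y z] unfolding F_def by blast+
    have "E i x0 x3" "E i x1 x4" "E i x2 x5" "E i x3 x6" using E that V by meson+
    moreover from this have "E i x0 x5" "E i x1 x6" using E that V by meson+
    moreover have "\<exists>(x, y) \<in> {(x0, x3), (x1, x4), (x2, x5), (x3, x6), (x0, x5), (x1, x6)}.
           cross A B x y \<and> R x y = even i"
      using that V unfolding F_def by (intro layered_chord[OF layered disj]) simp_all
    ultimately show ?thesis unfolding F_def by simp
  qed
  have "E (Suc i) u v \<longleftrightarrow> (\<exists>n\<le>2 ^ 3. (F i ^^ n) u v)"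
    using dbl_funpow[of "F i" V u v 3] F_V assms(2,3) by (simp add: F_def sep.simps(2))
  also have "\<dots> \<longleftrightarrow> (F i)\<^sup>*\<^sup>* u v"
  proof
    assume "(F i)\<^sup>*\<^sup>* u v"
    then obtain n where "n \<le> 5" "(F i ^^ n) u v" using relpowp_shrink[of "F i" u v, OF chord] by blast
    then show "\<exists>n\<le>2 ^ 3. (F i ^^ n) u v" by (intro exI[of _ n]) simp
  qed (auto simp: rtranclp_power)
  finally show ?thesis .
qed

lemma E_equiv: "(\<forall>x\<in>V. \<forall>y\<in>V. E i x y \<longrightarrow> E i y x) \<and>
    (\<forall>x\<in>V. \<forall>y\<in>V. \<forall>z\<in>V. E i x y \<longrightarrow> E i y z \<longrightarrow> E i x z)"
proof (induction i)
  case 0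
  show ?case by simp
next
  case (Suc i)
  have trans: "E i x z" if "E i x y" "E i y z" "x \<in> V" "y \<in> V" "z \<in> V" for x y z
    using conjunct2[OF Suc.IH] that by blast
  have E: "E (Suc i) u v \<longleftrightarrow> (F i)\<^sup>*\<^sup>* u v" if "u \<in> V" "v \<in> V" for u v
    using trans that by (rule E_Suc_aux)
  have "symp (F i)"
  proof (rule sympI)
    fix x y assume xy: "F i x y"
    have "E i y x" using conjunct1[OF Suc.IH] xy F_V[OF xy] unfolding F_def by blast
    moreover have "cross A B y x" "R y x = even i"
      using xy cross_sym[of A B x y] R_sym[of y x] unfolding F_def by simp_all
    ultimately show "F i y x" unfolding F_def by blast
  qed
  then have sym: "(F i)\<^sup>*\<^sup>* y x" if "(F i)\<^sup>*\<^sup>* x y" for x y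
    using sympD[OF symp_rtranclp that] by blast
  show ?case
  proof (intro conjI ballI impI)
    fix x y assume "x \<in> V" "y \<in> V" "E (Suc i) x y"
    then show "E (Suc i) y x" using E[of x y] E[of y x] sym[of x y] by blast
  next
    fix x y z assume "x \<in> V" "y \<in> V" "z \<in> V" "E (Suc i) x y" "E (Suc i) y z"
    then show "E (Suc i) x z"
      using E[of x y] E[of y z] E[of x z] rtranclp_trans[of "F i" x y z] by blast
  qed
qed

lemma E_sym: "E i x y \<Longrightarrow> x \<in> V \<Longrightarrow> y \<in> V \<Longrightarrow> E i y x"
  using E_equiv[of i] by blast

lemma E_trans: "E i x y \<Longrightarrow> E i y z \<Longrightarrow> x \<in> V \<Longrightarrow> y \<in> V \<Longrightarrow> z \<in> V \<Longrightarrow> E i x z"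
  using E_equiv[of i] by blast

lemma E_Suc: "u \<in> V \<Longrightarrow> v \<in> V \<Longrightarrow> E (Suc i) u v \<longleftrightarrow> (F i)\<^sup>*\<^sup>* u v"
  by (rule E_Suc_aux, rule E_trans)

lemma E_refl: "x \<in> V \<Longrightarrow> E i x x"
  by (cases i) (auto simp: E_Suc)

lemma E_Suc_D:
  assumes "E (Suc i) u v" "u \<in> V" "v \<in> V"
  shows "E i u v"
proof -
  have "(F i)\<^sup>*\<^sup>* u v" using assms by (simp add: E_Suc)
  then have "v \<in> V \<and> E i u v"
  proof (induction rule: rtranclp_induct)
    case base
    then show ?case using assms(2) E_refl by simp
  next
    case (step y z)
    have "E i y z" "z \<in> V" using F_V[OF step.hyps(2)] step.hyps(2) unfolding F_def by blast+
    then show ?case using step.IH assms(2) E_trans[of i u y z] by simp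
  qed
  then show ?thesis ..
qed

lemma E_antimono: "i \<le> j \<Longrightarrow> E j u v \<Longrightarrow> u \<in> V \<Longrightarrow> v \<in> V \<Longrightarrow> E i u v"
  by (induction j rule: dec_induct) (auto dest: E_Suc_D)

text \<open>Walks that start at \<open>u\<close> stay in its class of level \<open>i\<close>, so
  invariance of \<open>f\<close> is needed only there. It is applied to the map from vertices to
  children of the root.\<close>

lemma E_Suc_preserves:
  assumes "E (Suc i) u v" "u \<in> V" "v \<in> V"
    and f: "\<And>x y. F i x y \<Longrightarrow> E i u x \<Longrightarrow> E i u y \<Longrightarrow> f x = f y"
  shows "f u = f v"
proof -
  have "(F i)\<^sup>*\<^sup>* u v" using assms(1-3) E_Suc by blast
  then have "v \<in> V \<and> E i u v \<and> f u = f v"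
  proof (induction rule: rtranclp_induct)
    case base
    then show ?case using assms(2) E_refl by simp
  next
    case (step y z)
    have "E i y z" "z \<in> V" using F_V[OF step.hyps(2)] step.hyps(2) unfolding F_def by blast+
    then have "E i u z" using step.IH assms(2) E_trans F_V[OF step.hyps(2)] by blast
    then show ?case using step \<open>z \<in> V\<close> f[of y z] by simp
  qed
  then show ?thesis by blast
qed

text \<open>One of the two steps separates the children of the root: the one whose parity is opposite
  to the label of the root.\<close>

lemma E_layered:
  assumes "j \<le> k" "u \<in> V"
  shows "layered (cross A B) R (k - j) {v \<in> V. E (2 * j) u v}"
  using assms(1)
proof (induction j)
  case 0
  then show ?case using layered by simp
next
  case (Suc j)
  let ?C = "\<lambda>i. {v \<in> V. E i u v}"
  have sub: "?C (Suc i) \<subseteq> ?C i" for i using E_Suc_D assms(2) by blast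
  have k: "k - j = Suc (k - Suc j)" using Suc.prems by simp
  have "layered (cross A B) R (Suc (k - Suc j)) (?C (2 * j))"
    using Suc k by simp
  then obtain f b where
    fb: "\<forall>x\<in>?C (2 * j). \<forall>y\<in>?C (2 * j). cross A B x y \<and> f x \<noteq> f y \<longrightarrow> R x y = b"
    and f: "\<forall>c. layered (cross A B) R (k - Suc j) {x \<in> ?C (2 * j). f x = (c :: nat)}"
    by (cases rule: layered.cases) blast
  have "?C (Suc (Suc (2 * j))) \<subseteq> {x \<in> ?C (2 * j). f x = f u}"
  proof
    fix v assume v: "v \<in> ?C (Suc (Suc (2 * j)))"
    have vs: "v \<in> ?C (Suc (2 * j))" "v \<in> ?C (2 * j)" using sub v by blast+
    have "f u = f v"
    proof (cases b)
      case False
      show ?thesis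
      proof (rule E_Suc_preserves[of "2 * j"])
        fix x y assume xy: "F (2 * j) x y" "E (2 * j) u x" "E (2 * j) u y"
        then have "x \<in> ?C (2 * j)" "y \<in> ?C (2 * j)" using F_V by blast+
        moreover have "cross A B x y" "R x y" using xy(1) by (auto simp: F_def)
        ultimately show "f x = f y" using fb False by blast
      qed (use vs assms(2) in blast)+
    next
      case True
      show ?thesis
      proof (rule E_Suc_preserves[of "Suc (2 * j)"])
        fix x y assume xy: "F (Suc (2 * j)) x y" "E (Suc (2 * j)) u x" "E (Suc (2 * j)) u y"
        then have "x \<in> ?C (2 * j)" "y \<in> ?C (2 * j)" using F_V E_Suc_D assms(2) by blast+
        moreover have "cross A B x y" "\<not> R x y" using xy(1) by (auto simp: F_def)
        ultimately show "f x = f y" using fb True by blast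
      qed (use v assms(2) in blast)+
    qed
    then show "v \<in> {x \<in> ?C (2 * j). f x = f u}" using vs by simp
  qed
  then have "layered (cross A B) R (k - Suc j) (?C (Suc (Suc (2 * j))))"
    using f layered_mono by blast
  then show ?case by simp
qed

lemma E_final:
  assumes "cross A B u v" shows "\<not> E (2 * k) u v"
proof
  assume E: "E (2 * k) u v"
  have V: "u \<in> V" "v \<in> V" using assms subset by (auto simp: cross_def)
  have "layered (cross A B) R 0 {v \<in> V. E (2 * k) u v}"
    using E_layered[of k u] V by simp
  then show False
    using assms E V E_refl by (cases rule: layered.cases) blast
qed

text \<open>A pair together at level \<open>i\<close> whose adjacency equals \<open>even i\<close>
  is itself a step of \<open>F i\<close> and stays together. So the step that separates a pair has
  the opposite parity, and \<open>E_final\<close> guarantees that there is one.\<close>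

lemma adj_iff:
  assumes "cross A B u v"
  shows "R u v \<longleftrightarrow> (\<exists>i<2 * k. odd i \<and> E i u v \<and> \<not> E (Suc i) u v)"
proof -
  have V: "u \<in> V" "v \<in> V" using assms subset by (auto simp: cross_def)
  have last: "R u v = odd i" if "E i u v" "\<not> E (Suc i) u v" for i
  proof (rule ccontr)
    assume "R u v \<noteq> odd i"
    then have "F i u v" using that assms by (auto simp: F_def)
    then show False using that V E_Suc by blast
  qed
  have "\<exists>i<2 * k. E i u v \<and> \<not> E (Suc i) u v"
  proof (rule ccontr)
    assume *: "\<not> ?thesis"
    have "E i u v" if "i \<le> 2 * k" for i
      using that
    proof (induction i)
      case (Suc i)
      then show ?case using * by auto
    qed simp
    then show False using E_final assms by blast
  qed
  then show ?thesis using last by blast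
qed

end

section \<open>Queries closed under first-order operations\<close>

locale fo_closed =
  fixes U :: "'s \<Rightarrow> 'v set" and D :: "nat \<Rightarrow> ('s \<Rightarrow> (nat \<Rightarrow> 'v) \<Rightarrow> bool) \<Rightarrow> bool"
  assumes D_eq: "x < m \<Longrightarrow> y < m \<Longrightarrow> D m (\<lambda>s \<sigma>. \<sigma> x = \<sigma> y)"
    and D_not: "D m P \<Longrightarrow> D m (\<lambda>s \<sigma>. \<not> P s \<sigma>)"
    and D_conj: "D m P \<Longrightarrow> D m Q \<Longrightarrow> D m (\<lambda>s \<sigma>. P s \<sigma> \<and> Q s \<sigma>)"
    and D_ex: "D (Suc m) P \<Longrightarrow> D m (\<lambda>s \<sigma>. \<exists>v\<in>U s. P s (\<sigma>(m := v)))"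
begin

definition D1 :: "('s \<Rightarrow> 'v \<Rightarrow> bool) \<Rightarrow> bool" where
  "D1 P \<longleftrightarrow> (\<forall>m x. x < m \<longrightarrow> D m (\<lambda>s \<sigma>. P s (\<sigma> x)))"

definition D2 :: "('s \<Rightarrow> 'v \<Rightarrow> 'v \<Rightarrow> bool) \<Rightarrow> bool" where
  "D2 P \<longleftrightarrow> (\<forall>m x y. x < m \<longrightarrow> y < m \<longrightarrow> D m (\<lambda>s \<sigma>. P s (\<sigma> x) (\<sigma> y)))"

lemma D1I: "(\<And>m x. x < m \<Longrightarrow> D m (\<lambda>s \<sigma>. P s (\<sigma> x))) \<Longrightarrow> D1 P"
  by (simp add: D1_def)

lemma D1D: "D1 P \<Longrightarrow> x < m \<Longrightarrow> D m (\<lambda>s \<sigma>. P s (\<sigma> x))"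
  by (simp add: D1_def)

lemma D2I: "(\<And>m x y. x < m \<Longrightarrow> y < m \<Longrightarrow> D m (\<lambda>s \<sigma>. R s (\<sigma> x) (\<sigma> y))) \<Longrightarrow> D2 R"
  by (simp add: D2_def)

lemma D2D: "D2 R \<Longrightarrow> x < m \<Longrightarrow> y < m \<Longrightarrow> D m (\<lambda>s \<sigma>. R s (\<sigma> x) (\<sigma> y))"
  by (simp add: D2_def)

lemma D1_fst: "D1 P \<Longrightarrow> D2 (\<lambda>s x y. P s x)"
  by (rule D2I, rule D1D)

lemma D1_snd: "D1 P \<Longrightarrow> D2 (\<lambda>s x y. P s y)"
  by (rule D2I, rule D1D)

lemma D2_flip: "D2 R \<Longrightarrow> D2 (\<lambda>s x y. R s y x)"
  by (rule D2I, rule D2D)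

lemma D2_diag: "D2 R \<Longrightarrow> D1 (\<lambda>s x. R s x x)"
  by (rule D1I, rule D2D)

lemma D2_eq: "D2 (\<lambda>s x y. x = y)"
  by (rule D2I, rule D_eq)

lemma D1_not: "D1 P \<Longrightarrow> D1 (\<lambda>s x. \<not> P s x)"
  by (rule D1I, rule D_not, rule D1D)

lemma D2_not: "D2 R \<Longrightarrow> D2 (\<lambda>s x y. \<not> R s x y)"
  by (rule D2I, rule D_not, rule D2D)

lemma D1_conj: "D1 P \<Longrightarrow> D1 Q \<Longrightarrow> D1 (\<lambda>s x. P s x \<and> Q s x)"
  by (rule D1I, rule D_conj; rule D1D)

lemma D2_conj: "D2 R \<Longrightarrow> D2 S \<Longrightarrow> D2 (\<lambda>s x y. R s x y \<and> S s x y)"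
  by (rule D2I, rule D_conj; rule D2D)

lemma D1_disj:
  assumes "D1 P" "D1 Q"
  shows "D1 (\<lambda>s x. P s x \<or> Q s x)"
proof -
  have "D1 (\<lambda>s x. \<not> (\<not> P s x \<and> \<not> Q s x))"
    by (intro D1_not D1_conj assms)
  then show ?thesis by simp
qed

lemma D2_disj:
  assumes "D2 P" "D2 Q"
  shows "D2 (\<lambda>s x y. P s x y \<or> Q s x y)"
proof -
  have "D2 (\<lambda>s x y. \<not> (\<not> P s x y \<and> \<not> Q s x y))"
    by (intro D2_not D2_conj assms)
  then show ?thesis by simp
qed

lemma D2_imp:
  assumes "D2 P" "D2 Q"
  shows "D2 (\<lambda>s x y. P s x y \<longrightarrow> Q s x y)"
proof -
  have "D2 (\<lambda>s x y. \<not> (P s x y \<and> \<not> Q s x y))"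
    by (intro D2_not D2_conj assms)
  then show ?thesis by simp
qed

lemma D2_const: "D2 (\<lambda>s x y. b)"
proof -
  have "D2 (\<lambda>s x y. x = y \<and> \<not> x = y)" by (intro D2_conj D2_not D2_eq)
  then have "D2 (\<lambda>s x y. False)" by simp
  from this D2_not[OF this] show ?thesis by (cases b) simp_all
qed

lemma D1_const: "D1 (\<lambda>s x. b)"
  by (rule D2_diag, rule D2_const)

lemma D2_iff_const: "D2 R \<Longrightarrow> D2 (\<lambda>s x y. R s x y = b)"
  using D2_not[of R] by (cases b) simp_all

text \<open>The bound is a fixed number, so this is a finite disjunction and not a quantifier over
  vertices.\<close>

lemma D1_ex_less: "(\<And>i. i < (n :: nat) \<Longrightarrow> D1 (P i)) \<Longrightarrow> D1 (\<lambda>s x. \<exists>i<n. P i s x)"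
  by (induction n) (simp_all add: D1_const D1_disj Ex_less_Suc)

lemma D2_ex_less: "(\<And>i. i < (n :: nat) \<Longrightarrow> D2 (R i)) \<Longrightarrow> D2 (\<lambda>s x y. \<exists>i<n. R i s x y)"
  by (induction n) (simp_all add: D2_const D2_disj Ex_less_Suc)

lemma D1_ex: "D2 R \<Longrightarrow> D1 (\<lambda>s x. \<exists>z\<in>U s. R s x z)"
  unfolding D1_def
proof (intro allI impI)
  fix m x :: nat assume "D2 R" "x < m"
  then have "D (Suc m) (\<lambda>s \<sigma>. R s (\<sigma> x) (\<sigma> m))" by (simp add: D2_def)
  from D_ex[OF this] \<open>x < m\<close> show "D m (\<lambda>s \<sigma>. \<exists>z\<in>U s. R s (\<sigma> x) z)" by simp
qed

text \<open>Stated for relational composition, the shape of both \<open>dbl\<close> and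
  \<open>decoded\<close>.\<close>

lemma D2_ex: "D2 R \<Longrightarrow> D2 S \<Longrightarrow> D2 (\<lambda>s x y. \<exists>z\<in>U s. R s x z \<and> S s z y)"
  unfolding D2_def[of "\<lambda>s x y. \<exists>z\<in>U s. R s x z \<and> S s z y"]
proof (intro allI impI)
  fix m x y :: nat assume *: "D2 R" "D2 S" "x < m" "y < m"
  then have "D (Suc m) (\<lambda>s \<sigma>. R s (\<sigma> x) (\<sigma> m) \<and> S s (\<sigma> m) (\<sigma> y))"
    by (intro D_conj) (simp_all add: D2_def)
  from D_ex[OF this] * show "D m (\<lambda>s \<sigma>. \<exists>z\<in>U s. R s (\<sigma> x) z \<and> S s z (\<sigma> y))" by simp
qed

lemma D1_all: "D2 R \<Longrightarrow> D1 (\<lambda>s x. \<forall>z\<in>U s. R s x z)"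
  using D1_not[OF D1_ex[OF D2_not, of R]] by simp

lemma D2_cross:
  assumes "D1 (\<lambda>s x. x \<in> A s)" "D1 (\<lambda>s x. x \<in> B s)"
  shows "D2 (\<lambda>s. cross (A s) (B s))"
  unfolding cross_def
  by (intro D2_conj D2_disj D2_not D2_eq D1_fst D1_snd assms)

text \<open>Needed in both instances: for the formula that defines the sparse graph and for the
  program that computes the colors.\<close>

lemma D2_sep:
  assumes "D2 R" "D1 (\<lambda>s x. x \<in> A s)" "D1 (\<lambda>s x. x \<in> B s)"
  shows "D2 (\<lambda>s. sep (U s) (R s) (A s) (B s) i)"
proof (induction i)
  case 0
  show ?case by (simp add: D2_const)
next
  case (Suc i)
  have "D2 S \<Longrightarrow> D2 (\<lambda>s. (dbl (U s) ^^ j) (S s))" for j S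
  proof (induction j)
    case (Suc j)
    then show ?case unfolding funpow.simps comp_def dbl_def[of "U _" "(dbl (U _) ^^ j) _"]
      by (intro D2_ex)
  qed simp
  then show ?case
    unfolding sep.simps
    by this (intro D2_disj D2_conj D2_eq D2_iff_const D2_cross Suc assms)
qed

end

interpretation fo: fo_closed verts
  "\<lambda>m P. \<exists>\<eta>. fv \<eta> \<subseteq> {..<m} \<and> (\<forall>G \<sigma>. (\<forall>x<m. \<sigma> x \<in> verts G) \<longrightarrow> sat G \<sigma> \<eta> = P G \<sigma>)"
proof
  fix x y m :: nat
  assume "x < m" "y < m"
  then show "\<exists>\<eta>. fv \<eta> \<subseteq> {..<m} \<and>
      (\<forall>G \<sigma>. (\<forall>x<m. \<sigma> x \<in> verts G) \<longrightarrow> sat G \<sigma> \<eta> = (\<sigma> x = \<sigma> y))"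
    by (intro exI[of _ "Equal x y"]) auto
next
  fix m and P :: "'a cgraph \<Rightarrow> (nat \<Rightarrow> 'a) \<Rightarrow> bool"
  assume "\<exists>\<eta>. fv \<eta> \<subseteq> {..<m} \<and> (\<forall>G \<sigma>. (\<forall>x<m. \<sigma> x \<in> verts G) \<longrightarrow> sat G \<sigma> \<eta> = P G \<sigma>)"
  then obtain \<eta> where "fv \<eta> \<subseteq> {..<m}"
    "\<forall>G \<sigma>. (\<forall>x<m. \<sigma> x \<in> verts G) \<longrightarrow> sat G \<sigma> \<eta> = P G \<sigma>" by blast
  then show "\<exists>\<eta>. fv \<eta> \<subseteq> {..<m} \<and>
      (\<forall>G \<sigma>. (\<forall>x<m. \<sigma> x \<in> verts G) \<longrightarrow> sat G \<sigma> \<eta> = (\<not> P G \<sigma>))"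
    by (intro exI[of _ "Neg \<eta>"]) simp
next
  fix m and P Q :: "'a cgraph \<Rightarrow> (nat \<Rightarrow> 'a) \<Rightarrow> bool"
  assume "\<exists>\<eta>. fv \<eta> \<subseteq> {..<m} \<and> (\<forall>G \<sigma>. (\<forall>x<m. \<sigma> x \<in> verts G) \<longrightarrow> sat G \<sigma> \<eta> = P G \<sigma>)"
    and "\<exists>\<eta>. fv \<eta> \<subseteq> {..<m} \<and> (\<forall>G \<sigma>. (\<forall>x<m. \<sigma> x \<in> verts G) \<longrightarrow> sat G \<sigma> \<eta> = Q G \<sigma>)"
  then obtain \<eta> \<theta> where "fv \<eta> \<subseteq> {..<m}" "fv \<theta> \<subseteq> {..<m}"
    "\<forall>G \<sigma>. (\<forall>x<m. \<sigma> x \<in> verts G) \<longrightarrow> sat G \<sigma> \<eta> = P G \<sigma>"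
    "\<forall>G \<sigma>. (\<forall>x<m. \<sigma> x \<in> verts G) \<longrightarrow> sat G \<sigma> \<theta> = Q G \<sigma>" by blast
  then show "\<exists>\<eta>. fv \<eta> \<subseteq> {..<m} \<and>
      (\<forall>G \<sigma>. (\<forall>x<m. \<sigma> x \<in> verts G) \<longrightarrow> sat G \<sigma> \<eta> = (P G \<sigma> \<and> Q G \<sigma>))"
    by (intro exI[of _ "Conj \<eta> \<theta>"]) simp
next
  fix m and P :: "'a cgraph \<Rightarrow> (nat \<Rightarrow> 'a) \<Rightarrow> bool"
  assume "\<exists>\<eta>. fv \<eta> \<subseteq> {..<Suc m} \<and> (\<forall>G \<sigma>. (\<forall>x<Suc m. \<sigma> x \<in> verts G) \<longrightarrow> sat G \<sigma> \<eta> = P G \<sigma>)"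
  then obtain \<eta> where \<eta>: "fv \<eta> \<subseteq> {..<Suc m}"
    "\<And>G \<sigma>. (\<forall>x<Suc m. \<sigma> x \<in> verts G) \<Longrightarrow> sat G \<sigma> \<eta> = P G \<sigma>" by blast
  then show "\<exists>\<eta>. fv \<eta> \<subseteq> {..<m} \<and>
      (\<forall>G \<sigma>. (\<forall>x<m. \<sigma> x \<in> verts G) \<longrightarrow> sat G \<sigma> \<eta> = (\<exists>v\<in>verts G. P G (\<sigma>(m := v))))"
  proof (intro exI[of _ "Exi m \<eta>"] conjI allI impI)
    show "fv (Exi m \<eta>) \<subseteq> {..<m}" using \<eta>(1) by (auto simp: less_Suc_eq)
    fix G :: "'a cgraph" and \<sigma> assume "\<forall>x<m. \<sigma> x \<in> verts G"
    then show "sat G \<sigma> (Exi m \<eta>) = (\<exists>v\<in>verts G. P G (\<sigma>(m := v)))"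
      by (simp add: \<eta>(2) less_Suc_eq)
  qed
qed

lemma fo_adj: "fo.D2 adj"
  unfolding fo.D2_def
proof (intro allI impI)
  fix m x y :: nat assume "x < m" "y < m"
  then show "\<exists>\<eta>. fv \<eta> \<subseteq> {..<m} \<and> (\<forall>G \<sigma>. (\<forall>x<m. \<sigma> x \<in> verts G) \<longrightarrow>
      sat G \<sigma> \<eta> = adj G (\<sigma> x) (\<sigma> y))"
    by (intro exI[of _ "Edge x y"]) auto
qed

lemma fo_upred: "fo.D1 (\<lambda>G x. x \<in> upred G i)"
  unfolding fo.D1_def
proof (intro allI impI)
  fix m x :: nat assume "x < m"
  then show "\<exists>\<eta>. fv \<eta> \<subseteq> {..<m} \<and> (\<forall>G \<sigma>. (\<forall>x<m. \<sigma> x \<in> verts G) \<longrightarrow>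
      sat G \<sigma> \<eta> = (\<sigma> x \<in> upred G i))"
    by (intro exI[of _ "UPred i x"]) auto
qed

lemma fo_D2_formula:
  assumes "fo.D2 R"
  obtains \<eta> where "binary_fm \<eta>"
    "\<And>G u v. u \<in> verts G \<Longrightarrow> v \<in> verts G \<Longrightarrow> holds2 G \<eta> u v = R G u v"
proof -
  obtain \<eta> where \<eta>: "fv \<eta> \<subseteq> {..<2}"
    "\<forall>G \<sigma>. (\<forall>x<2. \<sigma> x \<in> verts G) \<longrightarrow> sat G \<sigma> \<eta> = R G (\<sigma> 0) (\<sigma> 1)"
    using assms unfolding fo.D2_def by (metis one_less_numeral_iff semiring_norm(76) zero_less_numeral)
  show thesis
  proof (rule that)
    show "binary_fm \<eta>" using \<eta>(1) by (auto simp: binary_fm_def)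
  qed (use \<eta>(2) in \<open>simp add: holds2_def\<close>)
qed

section \<open>Checking queries on random access machines\<close>

text \<open>A total-correctness triple with a bound on the steps rather than their number, so that
  branches of different cost can share one bound.\<close>

definition runs :: "prog \<Rightarrow> store \<Rightarrow> nat \<Rightarrow> (store \<Rightarrow> bool) \<Rightarrow> bool" where
  "runs c s B Q \<longleftrightarrow> (\<exists>t s'. exec c s t s' \<and> t \<le> B \<and> Q s')"

lemma runs_Skip: "Q s \<Longrightarrow> 1 \<le> B \<Longrightarrow> runs Skip s B Q"
  unfolding runs_def by (blast intro: exec.Skip)

lemma runs_Write:
  "Q (s(a := (s a)(eval s e := eval s e'))) \<Longrightarrow> 1 \<le> B \<Longrightarrow> runs (Write a e e') s B Q"
  unfolding runs_def by (blast intro: exec.Write)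

lemma runs_Seq:
  assumes "runs c s B (\<lambda>s'. runs c' s' B' Q)"
  shows "runs (Seq c c') s (B + B') Q"
proof -
  obtain t s' t' s'' where "exec c s t s'" "t \<le> B" "exec c' s' t' s''" "t' \<le> B'" "Q s''"
    using assms unfolding runs_def by blast
  then show ?thesis unfolding runs_def by (intro exI[of _ "t + t'"] exI[of _ s'']) (simp add: exec.Seq)
qed

lemma runs_Branch:
  assumes "eval s e \<noteq> 0 \<Longrightarrow> runs c s B Q" "eval s e = 0 \<Longrightarrow> runs c' s B Q"
  shows "runs (Branch e c c') s (1 + B) Q"
proof (cases "eval s e = 0")
  case True
  then obtain t s' where "exec c' s t s'" "t \<le> B" "Q s'" using assms(2) unfolding runs_def by blast
  with True show ?thesis
    unfolding runs_def by (intro exI[of _ "1 + t"] exI[of _ s']) (simp add: exec.BranchF[simplified])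
next
  case False
  then obtain t s' where "exec c s t s'" "t \<le> B" "Q s'" using assms(1) unfolding runs_def by blast
  with False show ?thesis
    unfolding runs_def by (intro exI[of _ "1 + t"] exI[of _ s']) (simp add: exec.BranchT[simplified])
qed

lemma runs_mono: "runs c s B Q \<Longrightarrow> B \<le> B' \<Longrightarrow> (\<And>s'. Q s' \<Longrightarrow> Q' s') \<Longrightarrow> runs c s B' Q'"
  unfolding runs_def by (meson order_trans)

text \<open>The invariant carries the iteration count; the bound charges one step for every test,
  including the final failing one.\<close>

lemma runs_Loop:
  fixes n :: nat
  assumes guard: "\<And>j s. I j s \<Longrightarrow> j \<le> n \<Longrightarrow> eval s e = 0 \<longleftrightarrow> j = n"
    and body: "\<And>j s. I j s \<Longrightarrow> j < n \<Longrightarrow> runs c s B (I (Suc j))"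
    and "I 0 s"
  shows "runs (Loop e c) s (1 + n * (1 + B)) (I n)"
proof -
  have "runs (Loop e c) s (1 + d * (1 + B)) (I n)" if "I (n - d) s" "d \<le> n" for d s
    using that
  proof (induction d arbitrary: s)
    case 0
    then have "exec (Loop e c) s 1 s" using guard[of n s] by (intro exec.LoopF) simp
    then show ?case using 0 unfolding runs_def by auto
  next
    case (Suc d)
    then have "Suc (n - Suc d) = n - d" by simp
    then obtain t s' where t: "exec c s t s'" "t \<le> B" "I (n - d) s'"
      using body[OF Suc.prems(1)] Suc.prems(2) unfolding runs_def by auto
    obtain t' s'' where t': "exec (Loop e c) s' t' s''" "t' \<le> 1 + d * (1 + B)" "I n s''"
      using Suc.IH[OF t(3)] Suc.prems(2) unfolding runs_def by auto
    have "exec (Loop e c) s (1 + t + t') s''"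
      using guard[OF Suc.prems(1)] Suc.prems(2) t t' by (intro exec.LoopT) auto
    moreover have "1 + t + t' \<le> 1 + Suc d * (1 + B)" using t(2) t'(2) by simp
    ultimately show ?case using t'(3) unfolding runs_def by blast
  qed
  from this[of n] assms(3) show ?thesis by simp
qed

text \<open>Array \<open>4\<close> holds the positions of the values of the variables, array \<open>5\<close> the products of
  these positions with the number of vertices (there is no multiplication to address the
  matrices), and entry \<open>m\<close> of array \<open>6\<close> receives the truth value of a query with \<open>m\<close>
  variables.\<close>

definition env :: "nat graph \<Rightarrow> nat set set \<Rightarrow> nat \<Rightarrow> (nat \<Rightarrow> nat) \<Rightarrow> store \<Rightarrow> bool" where
  "env G P m \<sigma> s \<longleftrightarrow> (\<forall>a<3. s a = input_store G P a) \<and>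
     (\<forall>x<m. s 4 x < card (verts G) \<and> s 5 x = card (verts G) * s 4 x \<and>
            \<sigma> x = sorted_list_of_set (verts G) ! s 4 x)"

text \<open>Array \<open>3\<close> is protected as well, so checking a query does not damage output
  already written. Entries from \<open>m\<close> on in the arrays from \<open>4\<close> on are
  scratch space.\<close>

definition frame :: "nat \<Rightarrow> store \<Rightarrow> store \<Rightarrow> bool" where
  "frame m s s' \<longleftrightarrow> (\<forall>a<4. s' a = s a) \<and> (\<forall>x<m. \<forall>a. s' a x = s a x)"

definition checks :: "prog \<Rightarrow> nat poly \<Rightarrow> nat \<Rightarrow> (nat graph \<times> nat set set \<Rightarrow> (nat \<Rightarrow> nat) \<Rightarrow> bool) \<Rightarrow> bool"
where
  "checks c p m Q \<longleftrightarrow> (\<forall>G P \<sigma> s. finite (verts G) \<longrightarrow> env G P m \<sigma> s \<longrightarrow>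
     runs c s (poly p (card (verts G))) (\<lambda>s'. frame m s s' \<and> s' 6 m = of_bool (Q (G, P) \<sigma>)))"

abbreviation "nverts \<equiv> Read 0 (Const 0)"

lemma env_frame: "env G P m \<sigma> s \<Longrightarrow> frame m s s' \<Longrightarrow> env G P m \<sigma> s'"
  unfolding env_def frame_def by auto

lemma frame_trans: "frame m s s' \<Longrightarrow> frame m s' s'' \<Longrightarrow> frame m s s''"
  unfolding frame_def by auto

lemma frame_Suc: "frame (Suc m) s s' \<Longrightarrow> frame m s s'"
  unfolding frame_def by auto

lemma frame_write: "4 \<le> a \<Longrightarrow> m \<le> x \<Longrightarrow> frame m s (s(a := (s a)(x := y)))"
  unfolding frame_def by auto

section \<open>Programs for atomic queries, connectives and quantifiers\<close>

lemma checks_write: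
  assumes "\<And>G P \<sigma> s. finite (verts G) \<Longrightarrow> env G P m \<sigma> s \<Longrightarrow> eval s e = of_bool (Q (G, P) \<sigma>)"
  shows "checks (Write 6 (Const m) e) [:1:] m Q"
  unfolding checks_def
  by (auto intro!: runs_Write frame_write simp: assms)

text \<open>Queries compare vertices, the machine compares positions; the two agree because the list
  is strictly increasing.\<close>

lemma nth_verts_eq:
  assumes "finite (V :: nat set)" "i < card V" "j < card V"
  shows "sorted_list_of_set V ! i = sorted_list_of_set V ! j \<longleftrightarrow> i = j"
    and "sorted_list_of_set V ! i < sorted_list_of_set V ! j \<longleftrightarrow> i < j"
  using assms sorted_wrt_nth_less[OF strict_sorted_list_of_set[of V], of i j]
    sorted_wrt_nth_less[OF strict_sorted_list_of_set[of V], of j i]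
  by (cases i j rule: linorder_cases; simp add: nth_eq_iff_index_eq)+

text \<open>Subtraction is truncated, so the two differences add up to 0 exactly when the positions
  agree.\<close>

lemma checks_eq: "x < m \<Longrightarrow> y < m \<Longrightarrow> checks (Write 6 (Const m) (Minus (Const 1) (Plus
    (Minus (Read 4 (Const x)) (Read 4 (Const y))) (Minus (Read 4 (Const y)) (Read 4 (Const x))))))
    [:1:] m (\<lambda>s \<sigma>. \<sigma> x = \<sigma> y)"
  by (rule checks_write) (auto simp: env_def nth_verts_eq)

text \<open>The inner difference truncates to 0 exactly when the position of \<open>x\<close> is the
  smaller one.\<close>

lemma checks_less: "x < m \<Longrightarrow> y < m \<Longrightarrow> checks (Write 6 (Const m) (Minus (Const 1)
    (Minus (Plus (Const 1) (Read 4 (Const x))) (Read 4 (Const y))))) [:1:] m (\<lambda>s \<sigma>. \<sigma> x < \<sigma> y)"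
  by (rule checks_write) (auto simp: env_def nth_verts_eq)

lemma input_store_pair:
  assumes "i < card (verts G)" "j < card (verts G)"
  shows "input_store G P 1 (card (verts G) * i + j) =
      of_bool (adj G (sorted_list_of_set (verts G) ! i) (sorted_list_of_set (verts G) ! j))"
    and "input_store G P 2 (card (verts G) * i + j) = of_bool (\<exists>A\<in>P.
      sorted_list_of_set (verts G) ! i \<in> A \<and> sorted_list_of_set (verts G) ! j \<in> A)"
proof -
  have "card (verts G) * i + j < card (verts G) * Suc i" using assms by simp
  also have "\<dots> \<le> card (verts G) * card (verts G)" using assms by (intro mult_le_mono2) simp
  finally show "input_store G P 1 (card (verts G) * i + j) =
      of_bool (adj G (sorted_list_of_set (verts G) ! i) (sorted_list_of_set (verts G) ! j))"
    and "input_store G P 2 (card (verts G) * i + j) = of_bool (\<exists>A\<in>P.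
      sorted_list_of_set (verts G) ! i \<in> A \<and> sorted_list_of_set (verts G) ! j \<in> A)"
    using assms by (simp_all add: input_store_def Let_def)
qed

lemma checks_adj: "x < m \<Longrightarrow> y < m \<Longrightarrow> checks (Write 6 (Const m)
    (Read 1 (Plus (Read 5 (Const x)) (Read 4 (Const y))))) [:1:] m (\<lambda>s \<sigma>. adj (fst s) (\<sigma> x) (\<sigma> y))"
  by (rule checks_write) (simp add: env_def input_store_pair[unfolded One_nat_def])

lemma checks_same: "x < m \<Longrightarrow> y < m \<Longrightarrow> checks (Write 6 (Const m)
    (Read 2 (Plus (Read 5 (Const x)) (Read 4 (Const y))))) [:1:] m
    (\<lambda>s \<sigma>. \<exists>A\<in>snd s. \<sigma> x \<in> A \<and> \<sigma> y \<in> A)"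
  by (rule checks_write) (simp add: env_def input_store_pair[unfolded One_nat_def])

lemma checks_not:
  assumes "checks c p m Q"
  shows "checks (Seq c (Write 6 (Const m) (Minus (Const 1) (Read 6 (Const m))))) (p + [:1:]) m
           (\<lambda>s \<sigma>. \<not> Q s \<sigma>)"
  unfolding checks_def
proof (intro allI impI)
  fix G P \<sigma> s assume "finite (verts G)" "env G P m \<sigma> s"
  with assms have "runs c s (poly p (card (verts G)))
      (\<lambda>s'. frame m s s' \<and> s' 6 m = of_bool (Q (G, P) \<sigma>))"
    by (simp add: checks_def)
  then show "runs (Seq c (Write 6 (Const m) (Minus (Const 1) (Read 6 (Const m))))) s
      (poly (p + [:1:]) (card (verts G))) (\<lambda>s'. frame m s s' \<and> s' 6 m = of_bool (\<not> Q (G, P) \<sigma>))"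
    unfolding poly_add
    by (intro runs_Seq) (auto elim!: runs_mono intro!: runs_Write frame_trans[OF _ frame_write])
qed

lemma checks_conj:
  assumes "checks c p m Q" "checks c' p' m Q'"
  shows "checks (Seq c (Branch (Read 6 (Const m)) c' Skip)) (p + ([:1:] + (p' + [:1:]))) m
           (\<lambda>s \<sigma>. Q s \<sigma> \<and> Q' s \<sigma>)"
  unfolding checks_def
proof (intro allI impI)
  fix G P \<sigma> s assume *: "finite (verts G)" "env G P m \<sigma> s"
  let ?R = "\<lambda>s'. frame m s s' \<and> s' 6 m = of_bool (Q (G, P) \<sigma> \<and> Q' (G, P) \<sigma>)"
  have "runs c s (poly p (card (verts G))) (\<lambda>s'. runs (Branch (Read 6 (Const m)) c' Skip) s'
      (1 + (poly p' (card (verts G)) + 1)) ?R)"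
  proof (rule runs_mono)
    show "runs c s (poly p (card (verts G))) (\<lambda>s'. frame m s s' \<and> s' 6 m = of_bool (Q (G, P) \<sigma>))"
      using assms(1) * by (simp add: checks_def)
    fix s' assume s': "frame m s s' \<and> s' 6 m = of_bool (Q (G, P) \<sigma>)"
    show "runs (Branch (Read 6 (Const m)) c' Skip) s' (1 + (poly p' (card (verts G)) + 1)) ?R"
    proof (rule runs_Branch)
      assume "eval s' (Read 6 (Const m)) \<noteq> 0"
      then have "Q (G, P) \<sigma>" using s' by (auto split: if_splits)
      moreover have "runs c' s' (poly p' (card (verts G)))
          (\<lambda>s''. frame m s' s'' \<and> s'' 6 m = of_bool (Q' (G, P) \<sigma>))"
        using assms(2) * s' env_frame unfolding checks_def by blast
      ultimately show "runs c' s' (poly p' (card (verts G)) + 1) ?R"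
        using s' by (elim runs_mono) (auto intro: frame_trans)
    next
      assume "eval s' (Read 6 (Const m)) = 0"
      then have "\<not> Q (G, P) \<sigma>" using s' by (auto split: if_splits)
      then show "runs Skip s' (poly p' (card (verts G)) + 1) ?R"
        using s' by (intro runs_Skip) auto
    qed
  qed simp
  from runs_Seq[OF this] show "runs (Seq c (Branch (Read 6 (Const m)) c' Skip)) s
      (poly (p + ([:1:] + (p' + [:1:]))) (card (verts G))) ?R"
    by (rule runs_mono) simp_all
qed

definition for_all_verts :: "nat \<Rightarrow> prog \<Rightarrow> prog" where
  "for_all_verts m c = Seq (Write 4 (Const m) (Const 0)) (Seq (Write 5 (Const m) (Const 0))
     (Loop (Minus nverts (Read 4 (Const m)))
       (Seq c (Seq (Write 4 (Const m) (Plus (Read 4 (Const m)) (Const 1)))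
                   (Write 5 (Const m) (Plus (Read 5 (Const m)) nverts))))))"

text \<open>Two initial writes and the final test cost 3; each iteration adds a test and two counter
  updates to the body, again 3. \<open>I_cong\<close> says that the invariant survives these
  updates.\<close>

lemma runs_for_all_verts:
  assumes env: "env G P m \<sigma> s"
    and init: "\<And>s'. frame m s s' \<Longrightarrow> s' 6 = s 6 \<Longrightarrow> I 0 s'"
    and body: "\<And>j s'. env G P (Suc m) (\<sigma>(m := sorted_list_of_set (verts G) ! j)) s' \<Longrightarrow> s' 4 m = j \<Longrightarrow>
       j < card (verts G) \<Longrightarrow> I j s' \<Longrightarrow>
       runs c s' B (\<lambda>s''. (\<forall>a<3. s'' a = s' a) \<and> (\<forall>a\<in>{4, 5}. \<forall>x\<le>m. s'' a x = s' a x) \<and> I (Suc j) s'')"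
    and I_cong: "\<And>j s' x y. I j s' \<Longrightarrow> I j (s'(4 := (s' 4)(m := x), 5 := (s' 5)(m := y)))"
  shows "runs (for_all_verts m c) s (3 + card (verts G) * (3 + B)) (I (card (verts G)))"
proof -
  let ?n = "card (verts G)"
  define J where "J j s' \<longleftrightarrow> env G P m \<sigma> s' \<and> s' 4 m = j \<and> s' 5 m = ?n * j \<and> I j s'" for j s'
  have "runs (Loop (Minus nverts (Read 4 (Const m))) (Seq c (Seq (Write 4 (Const m) (Plus (Read 4 (Const m)) (Const 1)))
                   (Write 5 (Const m) (Plus (Read 5 (Const m)) nverts))))) s' (1 + ?n * (1 + (B + 2))) (J ?n)"
    if s': "J 0 s'" for s'
  proof (rule runs_Loop)
    fix j s' assume "J j s'" "j \<le> ?n"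
    then show "eval s' (Minus nverts (Read 4 (Const m))) = 0 \<longleftrightarrow> j = ?n"
      by (auto simp: J_def env_def input_store_def)
  next
    fix j s' assume J: "J j s'" "j < ?n"
    have "env G P (Suc m) (\<sigma>(m := sorted_list_of_set (verts G) ! j)) s'"
      using J by (auto simp: J_def env_def less_Suc_eq)
    then have "runs c s' B (\<lambda>s''. (\<forall>a<3. s'' a = s' a) \<and> (\<forall>a\<in>{4, 5}. \<forall>x\<le>m. s'' a x = s' a x) \<and> I (Suc j) s'')"
      using J by (intro body) (auto simp: J_def)
    then show "runs (Seq c (Seq (Write 4 (Const m) (Plus (Read 4 (Const m)) (Const 1)))
                   (Write 5 (Const m) (Plus (Read 5 (Const m)) nverts)))) s' (B + 2) (J (Suc j))"
    proof (intro runs_Seq, elim runs_mono)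
      fix s'' assume s'': "(\<forall>a<3. s'' a = s' a) \<and> (\<forall>a\<in>{4, 5}. \<forall>x\<le>m. s'' a x = s' a x) \<and> I (Suc j) s''"
      have "J (Suc j) (s''(4 := (s'' 4)(m := Suc j), 5 := (s'' 5)(m := ?n * j + ?n)))"
        using J s'' I_cong[of "Suc j" s''] by (auto simp: J_def env_def)
      moreover have "s'' 4 m = j" "s'' 5 m = ?n * j" "s'' 0 0 = ?n"
        using J s'' by (auto simp: J_def env_def input_store_def)
      ultimately have "runs (Seq (Write 4 (Const m) (Plus (Read 4 (Const m)) (Const 1)))
                   (Write 5 (Const m) (Plus (Read 5 (Const m)) nverts))) s'' (1 + 1) (J (Suc j))"
        by (intro runs_Seq runs_Write) auto
      then show "runs (Seq (Write 4 (Const m) (Plus (Read 4 (Const m)) (Const 1)))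
                   (Write 5 (Const m) (Plus (Read 5 (Const m)) nverts))) s'' 2 (J (Suc j))"
        by (simp add: numeral_2_eq_2)
    qed simp
  qed (use s' in simp)
  moreover have "J 0 (s(4 := (s 4)(m := 0), 5 := (s 5)(m := 0)))"
    using env by (auto simp: J_def env_def frame_def intro!: init)
  ultimately have "runs (for_all_verts m c) s (1 + (1 + (1 + ?n * (1 + (B + 2))))) (J ?n)"
    unfolding for_all_verts_def by (intro runs_Seq runs_Write) simp_all
  then show ?thesis by (rule runs_mono) (auto simp: J_def algebra_simps)
qed

text \<open>Entry \<open>m\<close> of array \<open>6\<close> accumulates the disjunction while the
  inner query reports in entry \<open>Suc m\<close>. The constant 4 is the initial write plus the 3
  of the loop; the 5 is 3 per iteration plus the branch and its body.\<close>

lemma checks_ex: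
  assumes "checks c p (Suc m) Q"
  shows "checks (Seq (Write 6 (Const m) (Const 0)) (for_all_verts m
             (Seq c (Branch (Read 6 (Const (Suc m))) (Write 6 (Const m) (Const 1)) Skip))))
           ([:4:] + [:0, 1:] * ([:5:] + p)) m (\<lambda>s \<sigma>. \<exists>v\<in>verts (fst s). Q s (\<sigma>(m := v)))"
  unfolding checks_def
proof (intro allI impI)
  fix G P \<sigma> s assume *: "finite (verts G)" "env G P m \<sigma> s"
  let ?n = "card (verts G)" and ?vs = "sorted_list_of_set (verts G)"
  define I where "I j s' \<longleftrightarrow> frame m s s' \<and>
    s' 6 m = of_bool (\<exists>i<j. Q (G, P) (\<sigma>(m := ?vs ! i)))" for j s'
  let ?s = "s(6 := (s 6)(m := 0))"
  have "frame m s ?s" by (rule frame_write) simp_all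
  then have "env G P m \<sigma> ?s" by (rule env_frame[OF *(2)])
  then have "runs (for_all_verts m
      (Seq c (Branch (Read 6 (Const (Suc m))) (Write 6 (Const m) (Const 1)) Skip)))
      ?s (3 + ?n * (3 + (poly p ?n + (1 + 1)))) (I ?n)"
  proof (rule runs_for_all_verts)
    fix s' assume "frame m ?s s'" "s' 6 = ?s 6"
    then show "I 0 s'" using \<open>frame m s ?s\<close> frame_trans by (auto simp: I_def)
  next
    fix j s' assume env: "env G P (Suc m) (\<sigma>(m := ?vs ! j)) s'" and I: "I j s'"
    from assms env * have "runs c s' (poly p ?n) (\<lambda>s''. frame (Suc m) s' s'' \<and>
        s'' 6 (Suc m) = of_bool (Q (G, P) (\<sigma>(m := ?vs ! j))))"
      by (simp add: checks_def)
    then show "runs (Seq c (Branch (Read 6 (Const (Suc m))) (Write 6 (Const m) (Const 1)) Skip)) s'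
        (poly p ?n + (1 + 1)) (\<lambda>s''. (\<forall>a<3. s'' a = s' a) \<and>
          (\<forall>a\<in>{4, 5}. \<forall>x\<le>m. s'' a x = s' a x) \<and> I (Suc j) s'')" (is "runs _ _ _ ?R")
    proof (intro runs_Seq, elim runs_mono)
      fix s'' assume s'': "frame (Suc m) s' s'' \<and> s'' 6 (Suc m) = of_bool (Q (G, P) (\<sigma>(m := ?vs ! j)))"
      then have fr: "frame m s s''" using I frame_Suc frame_trans unfolding I_def by blast
      have m: "s'' 6 m = s' 6 m" "\<forall>a<3. s'' a = s' a" "\<forall>a\<in>{4, 5}. \<forall>x\<le>m. s'' a x = s' a x"
        using s'' by (simp_all add: frame_def less_Suc_eq_le)
      show "runs (Branch (Read 6 (Const (Suc m))) (Write 6 (Const m) (Const 1)) Skip) s'' (1 + 1) ?R"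
      proof (rule runs_Branch)
        assume "eval s'' (Read 6 (Const (Suc m))) \<noteq> 0"
        then have "Q (G, P) (\<sigma>(m := ?vs ! j))" using s'' by (auto split: if_splits)
        then show "runs (Write 6 (Const m) (Const 1)) s'' 1 ?R"
          using m frame_trans[OF fr frame_write[of 6 m m]]
          by (intro runs_Write) (auto simp: I_def)
      next
        assume "eval s'' (Read 6 (Const (Suc m))) = 0"
        then have "\<not> Q (G, P) (\<sigma>(m := ?vs ! j))" using s'' by (auto split: if_splits)
        then show "runs Skip s'' 1 ?R"
          using fr m I by (intro runs_Skip) (auto simp: I_def less_Suc_eq)
      qed
    qed simp
  next
    fix j s' x y assume "I j s'"
    then show "I j (s'(4 := (s' 4)(m := x), 5 := (s' 5)(m := y)))"
      by (auto simp: I_def frame_def)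
  qed
  then have "runs (Seq (Write 6 (Const m) (Const 0)) (for_all_verts m
      (Seq c (Branch (Read 6 (Const (Suc m))) (Write 6 (Const m) (Const 1)) Skip))))
      s (1 + (3 + ?n * (3 + (poly p ?n + (1 + 1))))) (I ?n)"
    by (intro runs_Seq runs_Write) simp_all
  then show "runs (Seq (Write 6 (Const m) (Const 0)) (for_all_verts m
      (Seq c (Branch (Read 6 (Const (Suc m))) (Write 6 (Const m) (Const 1)) Skip))))
      s (poly ([:4:] + [:0, 1:] * ([:5:] + p)) ?n)
      (\<lambda>s'. frame m s s' \<and> s' 6 m = of_bool (\<exists>v\<in>verts (fst (G, P)). Q (G, P) (\<sigma>(m := v))))"
  proof (rule runs_mono)
    have "(\<exists>i<?n. Q (G, P) (\<sigma>(m := ?vs ! i))) \<longleftrightarrow> (\<exists>v\<in>verts G. Q (G, P) (\<sigma>(m := v)))"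
      using *(1) by (metis in_set_conv_nth length_sorted_list_of_set set_sorted_list_of_set)
    then show "frame m s s' \<and> s' 6 m = of_bool (\<exists>v\<in>verts (fst (G, P)). Q (G, P) (\<sigma>(m := v)))"
      if "I ?n s'" for s'
      using that by (simp add: I_def)
  qed (simp add: algebra_simps)
qed

interpretation pt: fo_closed "\<lambda>s :: nat graph \<times> nat set set. verts (fst s)" "\<lambda>m Q. \<exists>c p. checks c p m Q"
proof
  fix x y m :: nat assume "x < m" "y < m"
  then show "\<exists>c p. checks c p m (\<lambda>s \<sigma>. \<sigma> x = \<sigma> y)" using checks_eq by blast
qed (use checks_not checks_conj checks_ex in blast)+

lemma pt_adj: "pt.D2 (\<lambda>s. adj (fst s))"
  by (rule pt.D2I) (use checks_adj in blast)

lemma pt_same: "pt.D2 (\<lambda>s x y. \<exists>A\<in>snd s. x \<in> A \<and> y \<in> A)"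
  by (rule pt.D2I) (use checks_same in blast)

lemma pt_less: "pt.D2 (\<lambda>s x y. x < y)"
  by (rule pt.D2I) (use checks_less in blast)

section \<open>Computing colorings defined by queries\<close>

text \<open>The factor is a row index known when the program is written, so the product unrolls into
  additions.\<close>

fun multiple :: "nat \<Rightarrow> expr \<Rightarrow> expr" where
  "multiple 0 e = Const 0"
| "multiple (Suc i) e = Plus e (multiple i e)"

lemma eval_multiple: "eval s (multiple i e) = i * eval s e"
  by (induction i) simp_all

text \<open>The function \<open>f\<close> describes the whole matrix, so the rows written earlier
  are carried along by the same invariant.\<close>

lemma runs_output_row:
  assumes c: "checks c p 1 (\<lambda>s \<sigma>. Q i s (\<sigma> 0))" and fin: "finite (verts G)"
    and s: "\<forall>a<3. s a = input_store G P a"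
    and rows: "\<forall>x < i * card (verts G). s 3 x = f x"
    and row: "\<And>j. j < card (verts G) \<Longrightarrow>
      f (i * card (verts G) + j) = of_bool (Q i (G, P) (sorted_list_of_set (verts G) ! j))"
  shows "runs (for_all_verts 0 (Seq c
           (Write 3 (Plus (multiple i nverts) (Read 4 (Const 0))) (Read 6 (Const 1))))) s
         (poly ([:3:] + [:0, 1:] * ([:4:] + p)) (card (verts G)))
         (\<lambda>s'. (\<forall>a<3. s' a = input_store G P a) \<and> (\<forall>x < Suc i * card (verts G). s' 3 x = f x))"
proof -
  let ?n = "card (verts G)" and ?vs = "sorted_list_of_set (verts G)"
  define I where "I j s' \<longleftrightarrow> (\<forall>a<3. s' a = input_store G P a) \<and> (\<forall>x < i * ?n + j. s' 3 x = f x)"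
    for j and s' :: store
  have "runs (for_all_verts 0 (Seq c
      (Write 3 (Plus (multiple i nverts) (Read 4 (Const 0))) (Read 6 (Const 1))))) s
      (3 + ?n * (3 + (poly p ?n + 1))) (I ?n)"
  proof (rule runs_for_all_verts)
    show "env G P 0 (\<lambda>_. 0) s" using s by (simp add: env_def)
  next
    fix s' assume "frame 0 s s'"
    then show "I 0 s'" using s rows by (auto simp: I_def frame_def)
  next
    fix j s' assume env: "env G P (Suc 0) ((\<lambda>_. 0)(0 := ?vs ! j)) s'" and j: "s' 4 0 = j" "j < ?n"
      and I: "I j s'"
    from c env fin have "runs c s' (poly p ?n) (\<lambda>s''. frame 1 s' s'' \<and>
        s'' 6 1 = of_bool (Q i (G, P) (?vs ! j)))"
      by (fastforce simp: checks_def)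
    then show "runs (Seq c (Write 3 (Plus (multiple i nverts) (Read 4 (Const 0))) (Read 6 (Const 1)))) s'
        (poly p ?n + 1) (\<lambda>s''. (\<forall>a<3. s'' a = s' a) \<and>
          (\<forall>a\<in>{4, 5}. \<forall>x\<le>0. s'' a x = s' a x) \<and> I (Suc j) s'')"
    proof (intro runs_Seq, elim runs_mono)
      fix s'' assume s'': "frame 1 s' s'' \<and> s'' 6 1 = of_bool (Q i (G, P) (?vs ! j))"
      have *: "\<forall>a<4. s'' a = s' a" "s'' 4 0 = j" "s'' 5 0 = s' 5 0" "s'' 0 0 = ?n"
        using s'' I j by (auto simp: frame_def I_def input_store_def)
      show "runs (Write 3 (Plus (multiple i nverts) (Read 4 (Const 0))) (Read 6 (Const 1))) s'' 1
          (\<lambda>s''. (\<forall>a<3. s'' a = s' a) \<and> (\<forall>a\<in>{4, 5}. \<forall>x\<le>0. s'' a x = s' a x) \<and> I (Suc j) s'')"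
        using * s'' j I row[of j] by (intro runs_Write) (auto simp: I_def eval_multiple less_Suc_eq)
    qed simp
  next
    fix j s' x y assume "I j s'"
    then show "I j (s'(4 := (s' 4)(0 := x), 5 := (s' 5)(0 := y)))" by (auto simp: I_def)
  qed
  then show ?thesis by (rule runs_mono) (auto simp: I_def algebra_simps)
qed

text \<open>One block of code per color; as \<open>M\<close> is fixed, the sum of their time bounds
  is still a polynomial.\<close>

lemma poly_time_coloring_queries:
  assumes Q: "\<And>i. i < M \<Longrightarrow> pt.D1 (Q i)" and I: "\<And>G P. (G, P) \<in> I \<Longrightarrow> finite (verts G)"
  shows "poly_time_coloring I M (\<lambda>G P i. if i < M then {v \<in> verts G. Q i (G, P) v} else {})"
proof -
  let ?f = "\<lambda>G P x. of_bool (Q (x div card (verts G)) (G, P)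
      (sorted_list_of_set (verts G) ! (x mod card (verts G)))) :: nat"
  have "\<exists>c p. \<forall>G P. finite (verts G) \<longrightarrow> runs c (input_store G P) (poly p (card (verts G)))
      (\<lambda>s'. (\<forall>a<3. s' a = input_store G P a) \<and> (\<forall>x < M * card (verts G). s' 3 x = ?f G P x))"
    using Q
  proof (induction M)
    case 0
    then show ?case by (intro exI[of _ Skip] exI[of _ "[:1:]"]) (auto intro!: runs_Skip)
  next
    case (Suc M)
    from Suc.IH[OF Suc.prems[OF less_SucI]] obtain c p where c: "\<And>G P. finite (verts G) \<Longrightarrow>
      runs c (input_store G P) (poly p (card (verts G))) (\<lambda>s'. (\<forall>a<3. s' a = input_store G P a) \<and>
        (\<forall>x < M * card (verts G). s' 3 x = ?f G P x))"
      by auto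
    obtain c' p' where c': "checks c' p' 1 (\<lambda>s \<sigma>. Q M s (\<sigma> 0))"
      using pt.D1D[OF Suc.prems[of M], of 0 1] by auto
    show ?case
    proof (intro exI allI impI)
      fix G :: "nat graph" and P :: "nat set set" assume fin: "finite (verts G)"
      show "runs (Seq c (for_all_verts 0 (Seq c'
           (Write 3 (Plus (multiple M nverts) (Read 4 (Const 0))) (Read 6 (Const 1))))))
           (input_store G P) (poly (p + ([:3:] + [:0, 1:] * ([:4:] + p'))) (card (verts G)))
           (\<lambda>s'. (\<forall>a<3. s' a = input_store G P a) \<and> (\<forall>x < Suc M * card (verts G). s' 3 x = ?f G P x))"
        unfolding poly_add[of p]
        by (rule runs_Seq, rule runs_mono[OF c[OF fin] order_refl],
            rule runs_output_row[where Q = Q and i = M, OF c' fin]) auto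
    qed
  qed
  then obtain c p where cp: "\<And>G P. finite (verts G) \<Longrightarrow>
      runs c (input_store G P) (poly p (card (verts G))) (\<lambda>s'. (\<forall>a<3. s' a = input_store G P a) \<and>
        (\<forall>x < M * card (verts G). s' 3 x = ?f G P x))" by blast
  show ?thesis
    unfolding poly_time_coloring_def
  proof (intro exI[of _ c] exI[of _ p] ballI, clarify)
    fix G P assume "(G, P) \<in> I"
    then have fin: "finite (verts G)" by (rule I)
    obtain t s where ts: "exec c (input_store G P) t s" "t \<le> poly p (card (verts G))"
      "\<And>x. x < M * card (verts G) \<Longrightarrow> s 3 x = ?f G P x"
      using cp[OF fin, of P] unfolding runs_def by blast
    have "s 3 (i * card (verts G) + j) = of_bool (sorted_list_of_set (verts G) ! j \<in>
        (if i < M then {v \<in> verts G. Q i (G, P) v} else {}))"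
      if ij: "i < M" "j < card (verts G)" for i j
    proof -
      have "i * card (verts G) + j < Suc i * card (verts G)" using ij by simp
      also have "\<dots> \<le> M * card (verts G)" using ij by (intro mult_le_mono1) simp
      finally have "s 3 (i * card (verts G) + j) = of_bool (Q i (G, P) (sorted_list_of_set (verts G) ! j))"
        using ts(3) ij by simp
      moreover have "sorted_list_of_set (verts G) ! j \<in> verts G"
        using ij fin by (metis length_sorted_list_of_set nth_mem set_sorted_list_of_set)
      ultimately show ?thesis using ij by simp
    qed
    then show "\<exists>t s. exec c (input_store G P) t s \<and> t \<le> poly p (card (verts G)) \<and>
        output_coloring M G s (\<lambda>i. if i < M then {v \<in> verts G. Q i (G, P) v} else {})"
      using ts(1,2) unfolding output_coloring_def Let_def by blast
  qed
qed

text \<open>The parts are numbered by their least elements: \<open>initial G P p\<close> is the union of the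
  first \<open>p\<close> parts.\<close>

primrec initial :: "nat graph \<Rightarrow> nat set set \<Rightarrow> nat \<Rightarrow> nat \<Rightarrow> bool" where
  "initial G P 0 = (\<lambda>v. False)"
| "initial G P (Suc p) = (\<lambda>v. initial G P p v \<or>
     (\<exists>w\<in>verts G. (\<exists>A\<in>P. v \<in> A \<and> w \<in> A) \<and> (\<forall>z\<in>verts G. z < w \<longrightarrow> initial G P p z)))"

text \<open>Empty once all parts have been numbered, a case that later lemmas on parts have to
  admit.\<close>

definition part :: "nat graph \<Rightarrow> nat set set \<Rightarrow> nat \<Rightarrow> nat set" where
  "part G P p = {v \<in> verts G. initial G P (Suc p) v \<and> \<not> initial G P p v}"

lemma pt_initial: "pt.D1 (\<lambda>s. initial (fst s) (snd s) p)"
proof (induction p)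
  case 0
  show ?case by (simp add: pt.D1_const)
next
  case (Suc p)
  have "pt.D2 (\<lambda>s w z. z < w \<longrightarrow> initial (fst s) (snd s) p z)"
    by (intro pt.D2_imp pt.D1_snd Suc pt.D2_flip[OF pt_less])
  then have "pt.D2 (\<lambda>s v w. (\<exists>A\<in>snd s. v \<in> A \<and> w \<in> A) \<and>
      (\<forall>z\<in>verts (fst s). z < w \<longrightarrow> initial (fst s) (snd s) p z))"
    by (intro pt.D2_conj pt_same pt.D1_snd pt.D1_all)
  then show ?case unfolding initial.simps by (intro pt.D1_disj Suc pt.D1_ex)
qed

lemma pt_verts: "pt.D1 (\<lambda>s v. v \<in> verts (fst s))"
proof -
  have "pt.D1 (\<lambda>s v. \<exists>w\<in>verts (fst s). v = w)" by (intro pt.D1_ex pt.D2_eq)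
  then show ?thesis by simp
qed

lemma pt_part: "pt.D1 (\<lambda>s v. v \<in> part (fst s) (snd s) p)"
  unfolding part_def mem_Collect_eq by (intro pt.D1_conj pt.D1_not pt_initial pt_verts)

section \<open>Cosplits and the numbering of their parts\<close>

lemma distinct_concat_nth:
  "distinct (concat xss) \<Longrightarrow> i < length xss \<Longrightarrow> j < length xss \<Longrightarrow>
   x \<in> set (xss ! i) \<Longrightarrow> x \<in> set (xss ! j) \<Longrightarrow> i = j"
proof (induction xss arbitrary: i j)
  case (Cons xs xss)
  have "x \<notin> set xs" if "j < length xss" "x \<in> set (xss ! j)" for j
    using Cons.prems(1) that by (auto simp: disjoint_iff)
  then show ?case using Cons by (cases i; cases j) auto
qed simp

lemma leaves_subtree: "s \<in> subtrees t \<Longrightarrow> set (leaves s) \<subseteq> set (leaves t)"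
  by (induction t) fastforce+

lemma self_subtree: "t \<in> subtrees t"
  by (cases t) simp_all

lemma is_lca_root:
  assumes "{u, v} \<subseteq> set (leaves (Node l ts))"
    and "\<And>t. t \<in> set ts \<Longrightarrow> \<not> {u, v} \<subseteq> set (leaves t)"
  shows "is_lca (Node l ts) u v s \<longleftrightarrow> s = Node l ts"
proof -
  have "s' = Node l ts" if "s' \<in> subtrees (Node l ts)" "{u, v} \<subseteq> set (leaves s')" for s'
    using that assms(2) leaves_subtree[of s'] by (simp; blast)
  then show ?thesis unfolding is_lca_def using assms(1) self_subtree by blast
qed

lemma is_lca_child:
  assumes "t \<in> set ts" "{u, v} \<subseteq> set (leaves t)"
    and only: "\<And>t'. t' \<in> set ts \<Longrightarrow> u \<in> set (leaves t') \<Longrightarrow> t' = t"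
  shows "is_lca (Node l ts) u v s \<longleftrightarrow> is_lca t u v s"
proof -
  have "s \<in> subtrees t" if lca: "is_lca (Node l ts) u v s"
  proof -
    have t: "t \<in> subtrees (Node l ts)" using assms(1) self_subtree by auto
    \<comment> \<open>A child is smaller than the tree, so the root is not the lowest subtree
      containing both leaves.\<close>
    have "t \<noteq> Node l ts" using size_list_estimation'[OF assms(1), of "size t" size] by auto
    then have "s \<noteq> Node l ts" using lca t assms(2) unfolding is_lca_def by blast
    then obtain t' where t': "t' \<in> set ts" "s \<in> subtrees t'" using lca unfolding is_lca_def by auto
    then have "u \<in> set (leaves t')" using lca leaves_subtree[OF t'(2)] unfolding is_lca_def by blast
    then show ?thesis using only t' by blast
  qed
  moreover have "s \<in> subtrees (Node l ts)" if "s \<in> subtrees t" using that assms(1) by auto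
  ultimately show ?thesis unfolding is_lca_def by blast
qed

text \<open>\<open>g\<close> extracts from a label the bit that decides pairs in \<open>X\<close>,
  which covers both kinds of trees. A pair in different children has the root as lowest common
  ancestor; otherwise the child inherits the pair.\<close>

lemma layered_tree:
  assumes "distinct (leaves T)" "height T \<le> k"
    and "\<And>u v. u \<in> W \<Longrightarrow> v \<in> W \<Longrightarrow> X u v \<Longrightarrow> u \<noteq> v \<and> {u, v} \<subseteq> set (leaves T) \<and>
      (R u v \<longleftrightarrow> (\<exists>l ts. is_lca T u v (Node l ts) \<and> g l))"
  shows "layered X R k W"
  using assms
proof (induction T arbitrary: k W)
  case (Leaf x)
  have "\<not> X u v" if "u \<in> W" "v \<in> W" for u v using Leaf.prems(3)[of u v] that by auto
  then show ?case by (blast intro: layered_no_cross)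
next
  case (Node l ts)
  obtain h where k: "k = Suc h" using Node.prems(2) by (cases k) auto
  have disjoint: "i = j" if "i < length ts" "j < length ts"
    "x \<in> set (leaves (ts ! i))" "x \<in> set (leaves (ts ! j))" for i j x
    using distinct_concat_nth[of "map leaves ts" i j x] Node.prems(1) that by simp
  \<comment> \<open>Vertices of \<open>W\<close> that are not leaves get an arbitrary index; this is
    harmless, as they occur in no pair of \<open>X\<close>.\<close>
  define f where "f u = (SOME i. i < length ts \<and> u \<in> set (leaves (ts ! i)))" for u
  have f: "f u < length ts \<and> u \<in> set (leaves (ts ! f u))" if "u \<in> set (leaves (Node l ts))" for u
  proof -
    have "\<exists>i. i < length ts \<and> u \<in> set (leaves (ts ! i))" using that by (auto simp: in_set_conv_nth[of _ ts])
    then show ?thesis unfolding f_def by (rule someI_ex)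
  qed
  show ?case unfolding k
  proof (rule layered_Suc[where f = f and b = "g l"], intro ballI impI)
    fix u v assume uv: "u \<in> W" "v \<in> W" "X u v \<and> f u \<noteq> f v"
    have *: "\<not> {u, v} \<subseteq> set (leaves t)" if t: "t \<in> set ts" for t
    proof
      assume uvt: "{u, v} \<subseteq> set (leaves t)"
      obtain i where i: "i < length ts" "t = ts ! i" using t by (auto simp: in_set_conv_nth)
      have "f x = i" if "x \<in> set (leaves t)" for x
      proof -
        have "x \<in> set (leaves (Node l ts))" using that t by auto
        then show ?thesis using f[of x] disjoint[of "f x" i x] i that by simp
      qed
      then have "f u = i" "f v = i" using uvt by simp_all
      then show False using uv by simp
    qed
    have "{u, v} \<subseteq> set (leaves (Node l ts))"
      and R: "R u v \<longleftrightarrow> (\<exists>l' ts'. is_lca (Node l ts) u v (Node l' ts') \<and> g l')"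
      using Node.prems(3)[of u v] uv by blast+
    from is_lca_root[OF this(1) *] show "R u v = g l" unfolding R by simp
  next
    show "\<forall>c. layered X R h {u \<in> W. f u = c}"
    proof
      fix c
      show "layered X R h {u \<in> W. f u = c}"
      proof (cases "c < length ts")
        case True
        then have t: "ts ! c \<in> set ts" by simp
        show ?thesis
        proof (rule Node.IH[OF t])
          show "distinct (leaves (ts ! c))" using Node.prems(1) t by (auto simp: distinct_concat_iff)
          have "height (ts ! c) \<le> Max (height ` set ts)" using t by (intro Max_ge) auto
          then show "height (ts ! c) \<le> h" using Node.prems(2) k by simp
          fix u v assume uv: "u \<in> {u \<in> W. f u = c}" "v \<in> {u \<in> W. f u = c}" "X u v"
          then have uv': "u \<noteq> v" "{u, v} \<subseteq> set (leaves (Node l ts))"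
            "R u v \<longleftrightarrow> (\<exists>l' ts'. is_lca (Node l ts) u v (Node l' ts') \<and> g l')"
            using Node.prems(3)[of u v] by blast+
          have sub: "{u, v} \<subseteq> set (leaves (ts ! c))" using uv uv'(2) f[of u] f[of v] by simp
          have "t' = ts ! c" if "t' \<in> set ts" "u \<in> set (leaves t')" for t'
            using that sub True disjoint by (metis in_set_conv_nth insert_subset)
          then show "u \<noteq> v \<and> {u, v} \<subseteq> set (leaves (ts ! c)) \<and>
              (R u v \<longleftrightarrow> (\<exists>l' ts'. is_lca (ts ! c) u v (Node l' ts') \<and> g l'))"
            using uv' sub is_lca_child[OF t sub] by simp
        qed
      next
        case False
        have "\<not> X u v" if "u \<in> W" "v \<in> W" "f u = c" for u v
          using Node.prems(3)[of u v] f[of u] that False by auto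
        then show ?thesis by (intro layered_no_cross) blast
      qed
    qed
  qed
qed

lemma bounded_cosplit_layered:
  assumes "bounded_cosplit N k G P" "A \<in> P" "B \<in> P"
  shows "layered (cross A B) (adj G) k (verts G)"
proof (cases "A = B")
  case True
  obtain T where T: "cotree T (induced G A)" "height T \<le> k"
    using assms unfolding bounded_cosplit_def cosplit_height_le_def by blast
  show ?thesis
  proof (rule layered_tree[of T _ _ _ _ id])
    fix u v assume "cross A B u v"
    then have "u \<noteq> v" "u \<in> A" "v \<in> A" using True by (auto simp: cross_def)
    then show "u \<noteq> v \<and> {u, v} \<subseteq> set (leaves T) \<and>
      (adj G u v \<longleftrightarrow> (\<exists>l ts. is_lca T u v (Node l ts) \<and> id l))"
      using T(1) by (auto simp: cotree_def tree_on_def induced_def)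
  qed (use T in \<open>simp_all add: cotree_def tree_on_def\<close>)
next
  case False
  then have disj: "A \<inter> B = {}"
    using assms unfolding bounded_cosplit_def two_cosplit_def partition_on_def by (meson disjointD)
  obtain T where T: "bicotree T (sides A) (semi_induced G A B)" "height T \<le> k"
    using assms False unfolding bounded_cosplit_def cosplit_height_le_def by blast
  show ?thesis
  \<comment> \<open>A crossing pair has one vertex on each side and labels are symmetric, so this
    single bit of a label decides it.\<close>
  proof (rule layered_tree[of T _ _ _ _ "\<lambda>f. f Side1 Side2"])
    fix u v assume uv: "cross A B u v"
    then have *: "u \<noteq> v" "u \<in> A \<union> B" "v \<in> A \<union> B" by (auto simp: cross_def)
    have "f (sides A u) (sides A v) = f Side1 Side2" if "is_lca T u v (Node f ts)" for f ts
    proof -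
      have "f Side2 Side1 = f Side1 Side2"
        using T(1) that unfolding bicotree_def is_lca_def by blast
      then show ?thesis using uv disj by (auto simp: cross_def sides_def)
    qed
    moreover have "adj (semi_induced G A B) u v = adj G u v"
      using uv by (auto simp: cross_def semi_induced_def)
    moreover have "adj (semi_induced G A B) u v \<longleftrightarrow>
        (\<exists>f ts. is_lca T u v (Node f ts) \<and> f (sides A u) (sides A v))"
      using T(1) * unfolding bicotree_def by (simp add: semi_induced_def)
    ultimately show "u \<noteq> v \<and> {u, v} \<subseteq> set (leaves T) \<and>
      (adj G u v \<longleftrightarrow> (\<exists>l ts. is_lca T u v (Node l ts) \<and> l Side1 Side2))"
      using T(1) * by (auto simp: bicotree_def tree_on_def semi_induced_def)
  qed (use T in \<open>simp_all add: bicotree_def tree_on_def\<close>)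
qed

section \<open>Parts as numbered sets\<close>

lemma initial_mono: "p \<le> q \<Longrightarrow> initial G P p v \<Longrightarrow> initial G P q v"
  by (induction q rule: dec_induct) auto

lemma part_disjoint: "p \<noteq> q \<Longrightarrow> part G P p \<inter> part G P q = {}"
  using initial_mono[of "Suc p" q] initial_mono[of "Suc q" p]
  by (cases p q rule: linorder_cases) (auto simp: part_def simp del: initial.simps)

text \<open>Let \<open>w\<close> be the least vertex outside the first \<open>p\<close> parts. A
  witness in the definition of \<open>initial\<close> cannot exceed \<open>w\<close>, and smaller
  ones lie in parts already taken, so exactly the part of \<open>w\<close> is added.\<close>

lemma initial_Suc:
  assumes fin: "finite (verts G)" and P: "partition_on (verts G) P"
    and Q: "Q \<subseteq> P" "{v \<in> verts G. initial G P p v} = \<Union>Q" and "\<Union>Q \<noteq> verts G"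
  obtains A where "A \<in> P - Q" "{v \<in> verts G. initial G P (Suc p) v} = \<Union>(insert A Q)"
    "part G P p = A"
proof -
  let ?I = "{v \<in> verts G. initial G P p v}"
  define w where "w = Min (verts G - ?I)"
  have ne: "verts G - ?I \<noteq> {}" "finite (verts G - ?I)" using assms by auto
  have w: "w \<in> verts G" "\<not> initial G P p w" using Min_in[OF ne(2,1)] unfolding w_def by auto
  have least: "initial G P p z" if "z \<in> verts G" "z < w" for z
    using that Min_le[OF ne(2), of z] unfolding w_def by auto
  obtain A where A: "A \<in> P" "w \<in> A" using w P by (auto simp: partition_on_def)
  have AQ: "A \<notin> Q" using A w Q(2) by auto
  have dj: "B = C" if "B \<in> P" "C \<in> P" "x \<in> B" "x \<in> C" for B C x
    using that P unfolding partition_on_def disjoint_def by blast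
  have sub: "B \<subseteq> verts G" if "B \<in> P" for B using that P by (auto simp: partition_on_def)
  have "initial G P (Suc p) v \<longleftrightarrow> v \<in> \<Union>(insert A Q)" if v: "v \<in> verts G" for v
  proof
    assume "initial G P (Suc p) v"
    then consider "initial G P p v" | w' B where "w' \<in> verts G" "B \<in> P" "v \<in> B" "w' \<in> B"
      "\<forall>z\<in>verts G. z < w' \<longrightarrow> initial G P p z" by auto
    then show "v \<in> \<Union>(insert A Q)"
    proof cases
      case 1
      then show ?thesis using v Q(2) by auto
    next
      case 2
      then have "w' \<le> w" using w by (meson not_le)
      then consider "w' = w" | "w' \<in> \<Union>Q" using least[of w'] 2 Q(2) by fastforce
      then show ?thesis
      proof cases
        case 1
        then show ?thesis using dj[of A B w] A 2 by blast
      next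
        case 2: 2
        then obtain C where "C \<in> Q" "w' \<in> C" by blast
        then show ?thesis using dj[of B C w'] \<open>B \<in> P\<close> \<open>v \<in> B\<close> \<open>w' \<in> B\<close> Q(1) by blast
      qed
    qed
  next
    assume "v \<in> \<Union>(insert A Q)"
    then consider "v \<in> A" | "v \<in> ?I" using Q(2) by auto
    then show "initial G P (Suc p) v"
      using A w least by cases auto
  qed
  then have eq: "{v \<in> verts G. initial G P (Suc p) v} = \<Union>(insert A Q)"
    using sub A Q(1) by blast
  have "A \<inter> \<Union>Q = {}" using dj A AQ Q(1) by blast
  moreover have "part G P p = {v \<in> verts G. initial G P (Suc p) v} - ?I"
    unfolding part_def by auto
  ultimately have "part G P p = A" unfolding eq Q(2) by blast
  with that A AQ eq show thesis by blast
qed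

lemma initial_union:
  assumes "finite (verts G)" "partition_on (verts G) P"
  shows "\<exists>Q\<subseteq>P. {v \<in> verts G. initial G P p v} = \<Union>Q \<and> (card Q = p \<or> \<Union>Q = verts G)"
proof (induction p)
  case 0
  show ?case by (intro exI[of _ "{}"]) simp
next
  case (Suc p)
  then obtain Q where Q: "Q \<subseteq> P" "{v \<in> verts G. initial G P p v} = \<Union>Q"
    "card Q = p \<or> \<Union>Q = verts G" by (elim exE conjE)
  have "finite Q" using finite_subset[OF Q(1) finite_elements[OF assms]] .
  show ?case
  proof (cases "\<Union>Q = verts G")
    case True
    then have "initial G P p v" if "v \<in> verts G" for v
      using Q(2) that by (metis (mono_tags, lifting) mem_Collect_eq)
    then have "{v \<in> verts G. initial G P (Suc p) v} = \<Union>Q" unfolding True by auto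
    then show ?thesis using Q(1) True by blast
  next
    case False
    then obtain A where "A \<in> P - Q" "{v \<in> verts G. initial G P (Suc p) v} = \<Union>(insert A Q)"
      by (rule initial_Suc[OF assms Q(1,2)])
    moreover from this have "card (insert A Q) = Suc p" using Q(3) False \<open>finite Q\<close> by simp
    moreover have "insert A Q \<subseteq> P" using calculation(1) Q(1) by blast
    ultimately show ?thesis by blast
  qed
qed

lemma part_in_partition:
  assumes "finite (verts G)" "partition_on (verts G) P"
  shows "part G P p \<in> P \<or> part G P p = {}"
proof -
  obtain Q where Q: "Q \<subseteq> P" "{v \<in> verts G. initial G P p v} = \<Union>Q"
    using initial_union[OF assms, of p] by (elim exE conjE)
  show ?thesis
  proof (cases "\<Union>Q = verts G")
    case True
    then have "initial G P p v" if "v \<in> verts G" for v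
      using Q(2) that by (metis (mono_tags, lifting) mem_Collect_eq)
    then have "part G P p = {}" unfolding part_def by simp
    then show ?thesis ..
  next
    case False
    from initial_Suc[OF assms Q this] show ?thesis by blast
  qed
qed

text \<open>If \<open>N\<close> distinct parts have been collected, they are all of \<open>P\<close>
  because \<open>card P \<le> N\<close>. The number of the part of \<open>v\<close> is the
  predecessor of the least \<open>p\<close> with \<open>initial G P p v\<close>.\<close>

lemma part_cover:
  assumes "finite (verts G)" "partition_on (verts G) P" "card P \<le> N" "v \<in> verts G"
  obtains p where "p < N" "v \<in> part G P p"
proof -
  obtain Q where Q: "Q \<subseteq> P" "{v \<in> verts G. initial G P N v} = \<Union>Q"
    "card Q = N \<or> \<Union>Q = verts G" using initial_union[OF assms(1,2), of N] by (elim exE conjE)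
  have "finite P" using assms(1,2) by (rule finite_elements)
  then have "\<Union>Q = verts G"
    using Q(1,3) assms(2,3) card_seteq[of P Q] partition_onD1[of "verts G" P] by auto
  then have v: "initial G P N v"
    using Q(2) assms(4) by (metis (mono_tags, lifting) mem_Collect_eq)
  define p where "p = (LEAST p. initial G P p v)"
  have "initial G P p v" using v unfolding p_def by (rule LeastI)
  moreover from this obtain q where q: "p = Suc q" by (cases p) auto
  moreover have "\<not> initial G P q v" using not_less_Least[of q "\<lambda>p. initial G P p v"] q p_def by simp
  moreover have "p \<le> N" unfolding p_def using v by (rule Least_le)
  ultimately show thesis using that[of q] assms(4) by (simp add: part_def del: initial.simps)
qed

lemma part_layered:
  assumes "bounded_cosplit N k G P" "finite (verts G)"
  shows "layered (cross (part G P p) (part G P q)) (adj G) k (verts G)"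
proof -
  have "partition_on (verts G) P" using assms by (simp add: bounded_cosplit_def two_cosplit_def)
  note part = part_in_partition[OF assms(2) this]
  show ?thesis
  proof (cases "part G P p = {} \<or> part G P q = {}")
    case True
    then show ?thesis by (intro layered_no_cross) (auto simp: cross_def)
  next
    case False
    then show ?thesis using bounded_cosplit_layered[OF assms(1)] part by blast
  qed
qed

definition rep :: "('v :: linorder \<Rightarrow> 'v \<Rightarrow> bool) \<Rightarrow> 'v set \<Rightarrow> 'v \<Rightarrow> bool" where
  "rep R A v \<longleftrightarrow> v \<in> A \<and> (\<forall>w\<in>A. R v w \<longrightarrow> v \<le> w)"

text \<open>\<open>j\<close> is the first level at which \<open>v\<close> or \<open>w\<close> is a representative, so an edge between them says
  that they are equivalent at level \<open>j\<close>. They are equivalent at a deeper level \<open>i\<close> iff the one that is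
  a representative at level \<open>j\<close> also represents the class of level \<open>i\<close> of the other.\<close>

definition near :: "nat \<Rightarrow> ('v \<Rightarrow> 'v \<Rightarrow> bool) \<Rightarrow> (nat \<Rightarrow> 'v \<Rightarrow> bool) \<Rightarrow> (nat \<Rightarrow> 'v \<Rightarrow> bool) \<Rightarrow>
    (nat \<Rightarrow> nat \<Rightarrow> 'v \<Rightarrow> bool) \<Rightarrow> (nat \<Rightarrow> nat \<Rightarrow> 'v \<Rightarrow> bool) \<Rightarrow> nat \<Rightarrow> 'v \<Rightarrow> 'v \<Rightarrow> bool" where
  "near n H ra rb la lb i v w \<longleftrightarrow> v = w \<or> H v w \<and>
     (\<exists>j<n. (ra j v \<or> rb j w) \<and> \<not> (\<exists>j'<j. ra j' v \<or> rb j' w) \<and>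
        (i \<le> j \<or> rb j w \<and> la i j v \<or> ra j v \<and> lb i j w))"

section \<open>Representatives and sparse links for one pair of parts\<close>

locale ordered_layered_pair = layered_pair V R A B k
  for V :: "'v :: linorder set" and R A B k +
  assumes finite_V: "finite V"
begin

definition "link n v w \<longleftrightarrow> v \<noteq> w \<and> (\<exists>i<n. E i v w \<and> (rep (E i) A v \<or> rep (E i) B w))"

definition "lab D i j v \<longleftrightarrow> (\<exists>w\<in>D. E i v w \<and> rep (E j) D w)"

lemma rep_unique:
  assumes "rep (E i) C v" "rep (E i) C w" "E i v w" "C \<subseteq> V"
  shows "v = w"
proof -
  have "v \<in> V" "w \<in> V" using assms unfolding rep_def by blast+
  then have "E i w v" using assms(3) E_sym by blast
  then show ?thesis using assms unfolding rep_def by (meson order_antisym)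
qed

lemma rep_exists:
  assumes "v \<in> V" "w \<in> C" "E i v w" "C \<subseteq> V"
  obtains x where "rep (E i) C x" "E i v x"
proof -
  let ?S = "{x \<in> C. E i v x}"
  have S: "finite ?S" "?S \<noteq> {}" using assms finite_subset[OF _ finite_V, of ?S] by auto
  define x where "x = Min ?S"
  have x: "x \<in> C" "E i v x" using Min_in[OF S] unfolding x_def by auto
  moreover have "x \<le> y" if "y \<in> C" "E i x y" for y
  proof -
    have "E i v y" using E_trans[OF x(2) that(2)] assms x(1) that(1) by blast
    then show ?thesis using Min_le[OF S(1)] that(1) unfolding x_def by simp
  qed
  ultimately show thesis using that[of x] unfolding rep_def by blast
qed

text \<open>The level-\<open>j\<close> class of \<open>v\<close> has only one representative in
  \<open>D\<close>, so the witness inside \<open>lab\<close> must be \<open>w\<close>. A color at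
  \<open>v\<close> thus answers a question about \<open>w\<close> without naming it.\<close>

lemma lab_iff:
  assumes "v \<in> V" "rep (E j) D w" "E j v w" "j \<le> i" "D \<subseteq> V"
  shows "lab D i j v \<longleftrightarrow> E i v w"
proof
  assume "lab D i j v"
  then obtain x where x: "x \<in> D" "E i v x" "rep (E j) D x" unfolding lab_def by blast
  have V: "x \<in> V" "w \<in> V" using assms x unfolding rep_def by blast+
  have "E j x v" using E_antimono[OF assms(4) x(2)] E_sym assms V by blast
  then have "E j x w" using E_trans assms V by blast
  then have "x = w" using rep_unique x assms by blast
  then show "E i v w" using x by simp
next
  assume "E i v w"
  then show "lab D i j v" using assms unfolding lab_def rep_def by blast
qed

text \<open>The level \<open>i0\<close> that created the link is unknown, but the first level
  \<open>j\<close> with a representative satisfies \<open>j \<le> i0\<close>, so nestedness yields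
  equivalence at level \<open>j\<close>. The case \<open>v = w\<close> is included because for
  \<open>A = B\<close> a vertex can be its own representative.\<close>

lemma near_iff:
  assumes "v \<in> A" "w \<in> B" and H: "H v w \<longleftrightarrow> link n v w"
    and "\<And>j. j < n \<Longrightarrow> ra j v \<longleftrightarrow> rep (E j) A v" "\<And>j. j < n \<Longrightarrow> rb j w \<longleftrightarrow> rep (E j) B w"
    and "\<And>j. j < n \<Longrightarrow> la i j v \<longleftrightarrow> lab B i j v" "\<And>j. j < n \<Longrightarrow> lb i j w \<longleftrightarrow> lab A i j w"
  shows "near n H ra rb la lb i v w \<longleftrightarrow> v = w \<or> link n v w \<and> E i v w"
proof (cases "v \<noteq> w \<and> link n v w")
  case False
  then show ?thesis using H by (auto simp: near_def link_def)
next
  case True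
  have V: "v \<in> V" "w \<in> V" using assms subset by blast+
  let ?r = "\<lambda>j. rep (E j) A v \<or> rep (E j) B w"
  obtain i0 where i0: "i0 < n" "E i0 v w" "?r i0" using True unfolding link_def by blast
  define j where "j = (LEAST j. ?r j)"
  have j: "?r j" "j \<le> i0" "\<And>j'. j' < j \<Longrightarrow> \<not> ?r j'"
    unfolding j_def using i0(3) by (rule LeastI, rule Least_le) (rule not_less_Least)
  have jn: "j < n" and Ej: "E j v w" and Ej': "E j w v"
    using i0 j(2) V E_antimono E_sym by (auto intro: le_less_trans)
  have "near n H ra rb la lb i v w \<longleftrightarrow>
      i \<le> j \<or> rep (E j) B w \<and> lab B i j v \<or> rep (E j) A v \<and> lab A i j w"
  proof -
    have "near n H ra rb la lb i v w \<longleftrightarrow> (\<exists>j<n. ?r j \<and> \<not> (\<exists>j'<j. ?r j') \<and>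
       (i \<le> j \<or> rep (E j) B w \<and> lab B i j v \<or> rep (E j) A v \<and> lab A i j w))"
      using True H assms(4-7) by (simp add: near_def cong: conj_cong)
    also have "\<dots> \<longleftrightarrow> i \<le> j \<or> rep (E j) B w \<and> lab B i j v \<or> rep (E j) A v \<and> lab A i j w"
      (is "?l \<longleftrightarrow> ?c j")
    proof
      assume ?l
      then obtain j' where "?r j'" "\<not> (\<exists>j''<j'. ?r j'')" "?c j'" by blast
      moreover from this have "j' = j" using j(1,3) by (metis linorder_neqE_nat)
      ultimately show "?c j" by simp
    qed (use j jn in blast)
    finally show ?thesis .
  qed
  also have "\<dots> \<longleftrightarrow> E i v w"
  proof (cases "i \<le> j")
    case True
    then show ?thesis using E_antimono Ej V by blast
  next
    case False
    then have "rep (E j) B w \<Longrightarrow> lab B i j v \<longleftrightarrow> E i v w"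
      "rep (E j) A v \<Longrightarrow> lab A i j w \<longleftrightarrow> E i w v"
      using lab_iff V Ej Ej' subset by simp_all
    moreover have "E i w v \<longleftrightarrow> E i v w" using E_sym V by blast
    ultimately show ?thesis using j(1) False by blast
  qed
  finally show ?thesis using True by simp
qed

text \<open>Two equivalent vertices need not be linked. But \<open>u\<close> is linked or equal to
  the representative \<open>b\<close> in \<open>B\<close>, \<open>v\<close> to the representative
  \<open>a\<close> in \<open>A\<close>, and \<open>a\<close> to \<open>b\<close>; this walk of three
  steps alternates between the sides.\<close>

lemma E_decode:
  assumes "u \<in> A" "v \<in> B" "i < n"
    and near: "\<And>a b. a \<in> A \<Longrightarrow> b \<in> B \<Longrightarrow> N a b \<longleftrightarrow> a = b \<or> link n a b \<and> E i a b"
  shows "E i u v \<longleftrightarrow> (\<exists>a\<in>A. \<exists>b\<in>B. N u b \<and> N a b \<and> N a v)"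
proof
  have V: "u \<in> V" "v \<in> V" using assms subset by blast+
  {
    assume E: "E i u v"
    obtain b where b: "rep (E i) B b" "E i u b" using rep_exists[OF V(1) assms(2) E subset(2)] .
    obtain a where a: "rep (E i) A a" "E i v a"
      using rep_exists[OF V(2) assms(1) E_sym[OF E V] subset(1)] .
    have ab: "a \<in> A" "b \<in> B" "a \<in> V" "b \<in> V" using a b subset unfolding rep_def by blast+
    have "E i a v" using E_sym a V ab by blast
    moreover have "E i a b" using calculation b E_sym[OF E V] E_trans V ab by meson
    ultimately have "N u b" "N a b" "N a v"
      using near ab assms a b unfolding link_def by blast+
    then show "\<exists>a\<in>A. \<exists>b\<in>B. N u b \<and> N a b \<and> N a v" using ab by blast
  next
    assume "\<exists>a\<in>A. \<exists>b\<in>B. N u b \<and> N a b \<and> N a v"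
    then obtain a b where ab: "a \<in> A" "b \<in> B" "N u b" "N a b" "N a v" by blast
    have ab': "a \<in> V" "b \<in> V" using ab subset by blast+
    have E: "E i u b" "E i a b" "E i a v" using near ab assms E_refl V ab' by metis+
    then have "E i b a" using E_sym ab' by blast
    then have "E i u a" using E(1) E_trans V ab' by blast
    then show "E i u v" using E(3) E_trans V ab' by blast
  }
qed

end

section \<open>The coloring and the two interpretations\<close>

text \<open>Double counting: each edge inside \<open>X\<close> leaves one of its ends, so the
  degrees in \<open>X\<close> sum to at most \<open>2 * M * card X\<close>.\<close>

lemma degenerate_out:
  assumes fin: "finite (verts G)"
    and adj: "\<And>u v. adj G u v \<Longrightarrow> v \<in> out u \<or> u \<in> out v"
    and out: "\<And>u. u \<in> verts G \<Longrightarrow> finite (out u) \<and> card (out u) \<le> M"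
  shows "degenerate (2 * M) G"
  unfolding degenerate_def
proof (intro allI impI, rule ccontr)
  fix X assume X: "X \<subseteq> verts G \<and> X \<noteq> {}"
    and deg: "\<not> (\<exists>v\<in>X. card {u \<in> X. adj G v u} \<le> 2 * M)"
  have finX: "finite X" using X fin finite_subset by blast
  let ?O = "SIGMA u:X. out u \<inter> X"
  have O: "finite ?O" "card ?O \<le> M * card X"
  proof -
    have "card ?O = (\<Sum>u\<in>X. card (out u \<inter> X))" using finX by simp
    also have "\<dots> \<le> (\<Sum>u\<in>X. M)"
    proof (rule sum_mono)
      fix u assume "u \<in> X"
      then have "finite (out u)" "card (out u) \<le> M" using X out by blast+
      then show "card (out u \<inter> X) \<le> M" using card_mono[of "out u" "out u \<inter> X"] by simp
    qed
    finally show "card ?O \<le> M * card X" by (simp add: mult.commute)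
  qed (use finX in simp)
  let ?E = "SIGMA u:X. {v \<in> X. adj G u v}"
  have "?E \<subseteq> ?O \<union> prod.swap ` ?O" using adj by (force simp: image_iff)
  then have "card ?E \<le> card (?O \<union> prod.swap ` ?O)" using O(1) by (intro card_mono) auto
  also have "\<dots> \<le> card ?O + card (prod.swap ` ?O)" by (rule card_Un_le)
  also have "\<dots> \<le> 2 * M * card X" using O card_image_le[OF O(1), of prod.swap] by linarith
  also have "\<dots> = (\<Sum>u\<in>X. 2 * M)" by simp
  also have "\<dots> < (\<Sum>u\<in>X. card {v \<in> X. adj G u v})"
    using X deg finX by (intro sum_strict_mono) (auto simp: not_le)
  also have "\<dots> = card ?E" using finX by simp
  finally show False by simp
qed

text \<open>\<open>Rep\<close> and \<open>Lab\<close> mention only the other part \<open>q\<close>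
  of a pair, since \<open>Part\<close> already tells the part of the vertex itself. Countability
  provides the predicate indices.\<close>

datatype colour = Part nat | Rep nat nat | Lab nat nat nat

instance colour :: countable
  by countable_datatype

definition part_sep :: "nat graph \<times> nat set set \<Rightarrow> nat \<Rightarrow> nat \<Rightarrow> nat \<Rightarrow> nat \<Rightarrow> nat \<Rightarrow> bool" where
  "part_sep s p q = sep (verts (fst s)) (adj (fst s)) (part (fst s) (snd s) p) (part (fst s) (snd s) q)"

fun has_colour :: "nat \<Rightarrow> nat graph \<times> nat set set \<Rightarrow> colour \<Rightarrow> nat \<Rightarrow> bool" where
  "has_colour N s (Part p) v \<longleftrightarrow> v \<in> part (fst s) (snd s) p"
| "has_colour N s (Rep q i) v \<longleftrightarrow>
     (\<exists>p<N. v \<in> part (fst s) (snd s) p \<and> rep (part_sep s p q i) (part (fst s) (snd s) p) v)"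
| "has_colour N s (Lab q i j) v \<longleftrightarrow>
     (\<exists>p<N. v \<in> part (fst s) (snd s) p \<and> (\<exists>w\<in>part (fst s) (snd s) q.
        part_sep s p q i v w \<and> rep (part_sep s p q j) (part (fst s) (snd s) q) w))"

lemma pt_part_sep: "pt.D2 (\<lambda>s. part_sep s p q i)"
  unfolding part_sep_def by (intro pt.D2_sep pt_adj pt_part)

lemma pt_rep: "pt.D1 (\<lambda>s. rep (part_sep s p q i) (part (fst s) (snd s) r))"
proof -
  have "pt.D1 (\<lambda>s v. v \<in> part (fst s) (snd s) r \<and>
      (\<forall>w\<in>verts (fst s). w \<in> part (fst s) (snd s) r \<and> part_sep s p q i v w \<longrightarrow> \<not> w < v))"
    by (intro pt.D1_conj pt_part pt.D1_all pt.D2_imp pt.D2_conj pt.D1_snd[OF pt_part] pt_part_sep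
        pt.D2_not pt.D2_flip[OF pt_less])
  moreover have "(\<lambda>s. rep (part_sep s p q i) (part (fst s) (snd s) r)) =
      (\<lambda>s v. v \<in> part (fst s) (snd s) r \<and>
        (\<forall>w\<in>verts (fst s). w \<in> part (fst s) (snd s) r \<and> part_sep s p q i v w \<longrightarrow> \<not> w < v))"
    unfolding rep_def by (intro ext) (auto simp: part_def not_less)
  ultimately show ?thesis by (simp only:)
qed

lemma pt_has_colour: "pt.D1 (\<lambda>s. has_colour N s c)"
proof (cases c)
  case (Part p)
  have "(\<lambda>s. has_colour N s (Part p)) = (\<lambda>s v. v \<in> part (fst s) (snd s) p)"
    by (intro ext) simp
  then show ?thesis using pt_part by (simp only: Part)
next
  case (Rep q i)
  have "pt.D1 (\<lambda>s v. \<exists>p<N. v \<in> part (fst s) (snd s) p \<and>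
      rep (part_sep s p q i) (part (fst s) (snd s) p) v)"
    by (intro pt.D1_ex_less pt.D1_conj pt_part pt_rep)
  moreover have "(\<lambda>s. has_colour N s (Rep q i)) = (\<lambda>s v. \<exists>p<N. v \<in> part (fst s) (snd s) p \<and>
      rep (part_sep s p q i) (part (fst s) (snd s) p) v)"
    by (intro ext) simp
  ultimately show ?thesis by (simp only: Rep)
next
  case (Lab q i j)
  have "pt.D1 (\<lambda>s v. \<exists>p<N. v \<in> part (fst s) (snd s) p \<and> (\<exists>w\<in>verts (fst s).
      part_sep s p q i v w \<and> rep (part_sep s p q j) (part (fst s) (snd s) q) w))"
    by (intro pt.D1_ex_less pt.D1_conj pt_part pt.D1_ex pt.D2_conj pt_part_sep pt.D1_snd[OF pt_rep])
  moreover have "(\<lambda>s. has_colour N s (Lab q i j)) = (\<lambda>s v. \<exists>p<N. v \<in> part (fst s) (snd s) p \<and>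
      (\<exists>w\<in>verts (fst s). part_sep s p q i v w \<and> rep (part_sep s p q j) (part (fst s) (snd s) q) w))"
    unfolding has_colour.simps rep_def by (intro ext) (auto simp: part_def)
  ultimately show ?thesis by (simp only: Lab)
qed

definition cosplit_coloring :: "nat \<Rightarrow> nat \<Rightarrow> nat graph \<Rightarrow> nat set set \<Rightarrow> nat \<Rightarrow> nat set" where
  "cosplit_coloring M N G P i =
     (if i < M then {v \<in> verts G. has_colour N (G, P) (from_nat i) v} else {})"

abbreviation col :: "'v cgraph \<Rightarrow> colour \<Rightarrow> 'v set" where
  "col G c \<equiv> upred G (to_nat c)"

text \<open>Evaluated in the original graph with its colors. Each end carries the index of the
  opposite part: \<open>Rep q\<close> at \<open>u\<close>, \<open>Rep p\<close> at
  \<open>v\<close>.\<close>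

definition linked :: "nat \<Rightarrow> nat \<Rightarrow> 'v cgraph \<Rightarrow> 'v \<Rightarrow> 'v \<Rightarrow> bool" where
  "linked N n G u v \<longleftrightarrow> (\<exists>p<N. \<exists>q<N. u \<in> col G (Part p) \<and> v \<in> col G (Part q) \<and>
     (\<exists>i<n. sep (verts G) (adj G) (col G (Part p)) (col G (Part q)) i u v \<and>
        (u \<in> col G (Rep q i) \<or> v \<in> col G (Rep p i))))"

definition col_near :: "nat \<Rightarrow> 'v cgraph \<Rightarrow> nat \<Rightarrow> nat \<Rightarrow> nat \<Rightarrow> 'v \<Rightarrow> 'v \<Rightarrow> bool" where
  "col_near n G p q = near n (adj G) (\<lambda>j v. v \<in> col G (Rep q j)) (\<lambda>j v. v \<in> col G (Rep p j))
     (\<lambda>i j v. v \<in> col G (Lab q i j)) (\<lambda>i j v. v \<in> col G (Lab p i j))"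

text \<open>The walk of \<open>E_decode\<close>, evaluated in the sparse graph and bracketed as two
  nested relational compositions to fit \<open>D2_ex\<close>.\<close>

definition decoded :: "nat \<Rightarrow> 'v cgraph \<Rightarrow> nat \<Rightarrow> nat \<Rightarrow> nat \<Rightarrow> 'v \<Rightarrow> 'v \<Rightarrow> bool" where
  "decoded n G p q i u v \<longleftrightarrow> (\<exists>b\<in>verts G. (b \<in> col G (Part q) \<and> col_near n G p q i u b) \<and>
     (\<exists>a\<in>verts G. (a \<in> col G (Part p) \<and> col_near n G p q i a b) \<and> col_near n G p q i a v))"

text \<open>The characterization \<open>adj_iff\<close>, with \<open>sep\<close> replaced by what
  the sparse graph reveals. Level \<open>Suc i\<close> can be \<open>2 * k\<close>, hence
  \<open>Suc (2 * k)\<close> levels.\<close>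

definition decoded_adj :: "nat \<Rightarrow> nat \<Rightarrow> 'v cgraph \<Rightarrow> 'v \<Rightarrow> 'v \<Rightarrow> bool" where
  "decoded_adj N k G u v \<longleftrightarrow> (\<exists>p<N. \<exists>q<N. u \<in> col G (Part p) \<and> v \<in> col G (Part q) \<and>
     (\<exists>i<2 * k. odd i \<and> decoded (Suc (2 * k)) G p q i u v \<and>
        \<not> decoded (Suc (2 * k)) G p q (Suc i) u v))"

lemma fo_linked: "fo.D2 (linked N n)"
  unfolding linked_def
  by (intro fo.D2_ex_less fo.D2_conj fo.D2_disj fo.D2_sep fo_adj fo_upred
      fo.D1_fst[OF fo_upred] fo.D1_snd[OF fo_upred])

lemma fo_col_near: "fo.D2 (\<lambda>G. col_near n G p q i)"
  unfolding col_near_def near_def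
  by (intro fo.D2_disj fo.D2_eq fo.D2_conj fo.D2_ex_less fo.D2_not fo_adj fo.D2_const
      fo.D1_fst[OF fo_upred] fo.D1_snd[OF fo_upred])

lemma fo_decoded: "fo.D2 (\<lambda>G. decoded n G p q i)"
  unfolding decoded_def
  by (intro fo.D2_ex fo.D2_conj fo.D1_snd[OF fo_upred] fo_col_near fo.D2_flip[OF fo_col_near])

lemma fo_decoded_adj: "fo.D2 (decoded_adj N k)"
  unfolding decoded_adj_def
  by (intro fo.D2_ex_less fo.D2_conj fo.D2_not fo.D2_const fo_decoded
      fo.D1_fst[OF fo_upred] fo.D1_snd[OF fo_upred])

section \<open>Both interpretations on one graph with a given cosplit\<close>

locale cosplit_graph =
  fixes N k M :: nat and G :: "nat graph" and P
  assumes simple: "simple_graph G" and cosplit: "bounded_cosplit N k G P"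
    and M: "\<And>p. p < N \<Longrightarrow> to_nat (Part p) < M"
      "\<And>q i. q < N \<Longrightarrow> i \<le> 2 * k \<Longrightarrow> to_nat (Rep q i) < M"
      "\<And>q i j. q < N \<Longrightarrow> i \<le> 2 * k \<Longrightarrow> j \<le> 2 * k \<Longrightarrow> to_nat (Lab q i j) < M"
begin

abbreviation "V \<equiv> verts G"
abbreviation "pt \<equiv> part G P"
abbreviation "n \<equiv> Suc (2 * k)"
abbreviation "X \<equiv> colored G (cosplit_coloring M N G P)"

lemma finite_V: "finite V"
  using simple by (simp add: simple_graph_def)

lemma X_simps: "verts X = V" "adj X = adj G"
  by (simp_all add: colored_def)

lemma part_subset: "pt p \<subseteq> V"
  unfolding part_def by blast

lemma pair: "ordered_layered_pair V (adj G) (pt p) (pt q) k"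
proof
  show "pt p = pt q \<or> pt p \<inter> pt q = {}" using part_disjoint by (cases "p = q") auto
  show "adj G u v = adj G v u" for u v using simple unfolding simple_graph_def by blast
qed (simp_all add: part_subset finite_V part_layered[OF cosplit finite_V])

lemma part_eq: "v \<in> pt p \<Longrightarrow> v \<in> pt q \<Longrightarrow> p = q"
  using part_disjoint by blast

lemma cover:
  assumes "v \<in> V"
  obtains p where "p < N" "v \<in> pt p"
  using part_cover[OF finite_V, of P N v thesis] cosplit that assms
  by (auto simp: bounded_cosplit_def two_cosplit_def)

lemma col_X:
  assumes "to_nat c < M"
  shows "col X c = {v \<in> V. has_colour N (G, P) c v}"
  using assms by (simp add: colored_def cosplit_coloring_def)

lemma col_Part: "p < N \<Longrightarrow> col X (Part p) = pt p"
  using part_subset by (auto simp: col_X M)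

text \<open>Parts are disjoint, so the quantifier over part numbers in the colors and formulas
  collapses to the actual part.\<close>

lemma ex_part:
  assumes "p < N" "v \<in> pt p"
  shows "(\<exists>p'<N. v \<in> pt p' \<and> Q p') \<longleftrightarrow> Q p"
proof
  assume "\<exists>p'<N. v \<in> pt p' \<and> Q p'"
  then obtain p' where "v \<in> pt p'" "Q p'" by blast
  then show "Q p" using part_eq[OF assms(2), of p'] by simp
qed (use assms in blast)

lemma col_Rep:
  assumes "p < N" "q < N" "i < n" "v \<in> pt p"
  shows "v \<in> col X (Rep q i) \<longleftrightarrow> rep (sep V (adj G) (pt p) (pt q) i) (pt p) v"
proof -
  have "to_nat (Rep q i) < M" "v \<in> V" using assms M(2) part_subset[of p] by (simp_all, blast)
  then show ?thesis
    using ex_part[OF assms(1,4)] by (simp add: col_X part_sep_def del: sep.simps)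
qed

lemma col_Lab:
  assumes "p < N" "q < N" "i < n" "j < n" "v \<in> pt p"
  shows "v \<in> col X (Lab q i j) \<longleftrightarrow>
    (\<exists>w\<in>pt q. sep V (adj G) (pt p) (pt q) i v w \<and> rep (sep V (adj G) (pt p) (pt q) j) (pt q) w)"
proof -
  have "to_nat (Lab q i j) < M" "v \<in> V" using assms M(3) part_subset[of p] by (simp_all, blast)
  then show ?thesis
    using ex_part[OF assms(1,5)] by (simp add: col_X part_sep_def del: sep.simps)
qed

abbreviation "pair_link p q \<equiv> ordered_layered_pair.link V (adj G) (pt p) (pt q) n"

lemma pair_link_def: "pair_link p q u v \<longleftrightarrow> u \<noteq> v \<and> (\<exists>i<n. sep V (adj G) (pt p) (pt q) i u v \<and>
    (rep (sep V (adj G) (pt p) (pt q) i) (pt p) u \<or> rep (sep V (adj G) (pt p) (pt q) i) (pt q) v))"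
  using ordered_layered_pair.link_def[OF pair] .

lemma linked_X:
  assumes "p < N" "q < N" "u \<in> pt p" "v \<in> pt q" "u \<noteq> v"
  shows "linked N n X u v \<longleftrightarrow> pair_link p q u v"
proof -
  have "linked N n X u v \<longleftrightarrow> (\<exists>i<n. sep V (adj G) (pt p) (pt q) i u v \<and>
      (u \<in> col X (Rep q i) \<or> v \<in> col X (Rep p i)))" (is "_ \<longleftrightarrow> ?R")
  proof
    assume "linked N n X u v"
    then obtain p' q' i where *: "p' < N" "q' < N" "u \<in> col X (Part p')" "v \<in> col X (Part q')" "i < n"
      "sep V (adj G) (col X (Part p')) (col X (Part q')) i u v"
      "u \<in> col X (Rep q' i) \<or> v \<in> col X (Rep p' i)"
      unfolding linked_def X_simps by blast
    then have "p' = p" "q' = q" using assms(1-4) part_eq[of u p p'] part_eq[of v q q'] by (simp_all only: col_Part)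
    then show ?R using *(5-7) assms(1,2) by (auto simp only: col_Part)
  next
    assume ?R
    then have "u \<in> col X (Part p)" "v \<in> col X (Part q)"
      "\<exists>i<n. sep V (adj G) (col X (Part p)) (col X (Part q)) i u v \<and>
        (u \<in> col X (Rep q i) \<or> v \<in> col X (Rep p i))"
      using assms(1-4) by (simp_all only: col_Part)
    then show "linked N n X u v"
      using assms(1,2) unfolding linked_def X_simps by blast
  qed
  also have "\<dots> \<longleftrightarrow> pair_link p q u v"
    unfolding pair_link_def
    using assms col_Rep[of p q _ u] col_Rep[of q p _ v] sep_swap[of V "adj G" "pt q" "pt p"] by auto
  finally show ?thesis .
qed

lemma pair_link_sym:
  assumes "u \<in> pt p" "v \<in> pt q" "pair_link p q u v"
  shows "pair_link q p v u"
proof -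
  interpret ordered_layered_pair V "adj G" "pt p" "pt q" k by (rule pair)
  have "u \<in> V" "v \<in> V" using assms subset by blast+
  then show ?thesis
    using assms(3) E_sym unfolding pair_link_def sep_swap[of V "adj G" "pt q" "pt p"] by blast
qed

end

locale cosplit_graph_interp = cosplit_graph +
  fixes \<phi> \<psi>
  assumes \<phi>: "\<And>(G :: nat cgraph) u v. u \<in> verts G \<Longrightarrow> v \<in> verts G \<Longrightarrow> holds2 G \<phi> u v = linked N n G u v"
    and \<psi>: "\<And>(G :: nat cgraph) u v. u \<in> verts G \<Longrightarrow> v \<in> verts G \<Longrightarrow> holds2 G \<psi> u v = decoded_adj N k G u v"
begin

abbreviation "H \<equiv> interp \<phi> X"

lemma H_simps: "verts H = V" "upred H = upred X"
  by (simp_all add: interp_def colored_def)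

text \<open>Pairs of parts do not interfere: the parts of \<open>u\<close> and \<open>v\<close> are
  determined, so only links of this pair produce the edge. The symmetrization in
  \<open>interp\<close> adds nothing, as links are symmetric.\<close>

lemma adj_H:
  assumes "p < N" "q < N" "u \<in> pt p" "v \<in> pt q"
  shows "adj H u v \<longleftrightarrow> pair_link p q u v"
proof -
  have V: "u \<in> V" "v \<in> V" using assms part_subset by blast+
  then have "adj H u v \<longleftrightarrow> u \<noteq> v \<and> (linked N n X u v \<or> linked N n X v u)"
    by (simp add: interp_def X_simps \<phi>)
  also have "\<dots> \<longleftrightarrow> u \<noteq> v \<and> (pair_link p q u v \<or> pair_link q p v u)"
    using linked_X[OF assms] linked_X[OF assms(2,1,4,3)] by auto
  also have "\<dots> \<longleftrightarrow> pair_link p q u v"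
    using pair_link_sym[OF assms(4,3)] by (auto simp: pair_link_def)
  finally show ?thesis .
qed

lemma simple_H: "simple_graph H"
  unfolding simple_graph_def H_simps using finite_V by (auto simp: interp_def X_simps)

text \<open>Edges are oriented towards a representative. A vertex has at most one representative for
  each of \<open>N\<close> parts and \<open>n\<close> levels; the factor 2 comes from
  \<open>degenerate_out\<close>.\<close>

lemma degenerate_H: "degenerate (2 * (N * n)) H"
proof (rule degenerate_out)
  define out where "out u = {v. \<exists>p<N. \<exists>q<N. \<exists>i<n. u \<in> pt p \<and> v \<in> pt q \<and>
    sep V (adj G) (pt p) (pt q) i u v \<and> rep (sep V (adj G) (pt p) (pt q) i) (pt q) v}" for u
  show "finite (verts H)" using H_simps finite_V by simp
  show "v \<in> out u \<or> u \<in> out v" if uv: "adj H u v" for u v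
  proof -
    have V: "u \<in> V" "v \<in> V" using simple_H uv unfolding simple_graph_def H_simps by blast+
    obtain p where p: "p < N" "u \<in> pt p" using cover[OF V(1)] .
    obtain q where q: "q < N" "v \<in> pt q" using cover[OF V(2)] .
    note pq = p q
    interpret ordered_layered_pair V "adj G" "pt p" "pt q" k by (rule pair)
    obtain i where i: "i < n" "sep V (adj G) (pt p) (pt q) i u v"
      "rep (sep V (adj G) (pt p) (pt q) i) (pt p) u \<or> rep (sep V (adj G) (pt p) (pt q) i) (pt q) v"
      using iffD1[OF adj_H[OF pq(1,3,2,4)] uv] unfolding pair_link_def by blast
    have "sep V (adj G) (pt p) (pt q) i v u" using i(2) V E_sym by blast
    then have vu: "sep V (adj G) (pt q) (pt p) i v u" by (simp only: sep_swap[of V "adj G" "pt q"])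
    from i(3) show ?thesis
    proof
      assume "rep (sep V (adj G) (pt p) (pt q) i) (pt p) u"
      then have "rep (sep V (adj G) (pt q) (pt p) i) (pt p) u"
        by (simp only: sep_swap[of V "adj G" "pt q"])
      then show ?thesis using vu pq i(1) unfolding out_def by blast
    next
      assume "rep (sep V (adj G) (pt p) (pt q) i) (pt q) v"
      then show ?thesis using i pq unfolding out_def by blast
    qed
  qed
  show "finite (out u) \<and> card (out u) \<le> N * n" if "u \<in> verts H" for u
  proof -
    have u: "u \<in> V" using that H_simps by simp
    obtain p where p: "p < N" "u \<in> pt p" using cover[OF u] .
    \<comment> \<open>The choice is unambiguous, since a class has at most one representative in
      \<open>pt q\<close>; this bounds \<open>out u\<close> by the number of pairs
      \<open>(q, i)\<close>.\<close>
    define f where "f = (\<lambda>(q, i). SOME v. v \<in> pt q \<and> sep V (adj G) (pt p) (pt q) i u v \<and>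
      rep (sep V (adj G) (pt p) (pt q) i) (pt q) v)"
    have "out u \<subseteq> f ` ({..<N} \<times> {..<n})"
    proof
      fix v assume "v \<in> out u"
      then obtain p' q i where *: "q < N" "i < n" "u \<in> pt p'" "v \<in> pt q"
        "sep V (adj G) (pt p') (pt q) i u v" "rep (sep V (adj G) (pt p') (pt q) i) (pt q) v"
        unfolding out_def by blast
      have "p' = p" using part_eq *(3) p(2) .
      note v = *(4-6)[unfolded this]
      interpret ordered_layered_pair V "adj G" "pt p" "pt q" k by (rule pair)
      have "w = v" if w: "w \<in> pt q" "E i u w" "rep (E i) (pt q) w" for w
      proof -
        have V: "v \<in> V" "w \<in> V" using v w part_subset by blast+
        have "E i w u" using E_sym w(2) u V by blast
        then have "E i w v" using E_trans v(2) u V by blast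
        then show ?thesis using rep_unique[OF w(3) v(3)] part_subset by blast
      qed
      then have "f (q, i) = v"
        unfolding f_def prod.case using v by (intro some_equality conjI) blast+
      then show "v \<in> f ` ({..<N} \<times> {..<n})" using *(1,2) by force
    qed
    moreover have "finite (f ` ({..<N} \<times> {..<n}))" "card (f ` ({..<N} \<times> {..<n})) \<le> N * n"
      using card_image_le[of "{..<N} \<times> {..<n}" f] by (simp_all add: card_cartesian_product)
    ultimately show ?thesis
      using finite_subset[of "out u"] card_mono[of "f ` ({..<N} \<times> {..<n})" "out u"] by simp
  qed
qed

text \<open>The colors supply all hypotheses of \<open>near_iff\<close>. At vertices of
  \<open>pt q\<close> they are stated for the pair \<open>(q, p)\<close>, which
  \<open>sep_swap\<close> identifies with \<open>(p, q)\<close>.\<close>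

lemma decoded_H:
  assumes "p < N" "q < N" "i < n" "u \<in> pt p" "v \<in> pt q"
  shows "decoded n H p q i u v \<longleftrightarrow> sep V (adj G) (pt p) (pt q) i u v"
proof -
  interpret ordered_layered_pair V "adj G" "pt p" "pt q" k by (rule pair)
  have near: "col_near n H p q i a b \<longleftrightarrow> a = b \<or> link n a b \<and> E i a b"
    if "a \<in> pt p" "b \<in> pt q" for a b
    unfolding col_near_def H_simps
  proof (rule near_iff)
    show "adj H a b \<longleftrightarrow> link n a b" using adj_H assms that by blast
    show "a \<in> col X (Rep q j) \<longleftrightarrow> rep (E j) (pt p) a" if "j < n" for j
      using col_Rep assms \<open>a \<in> pt p\<close> that by blast
    show "b \<in> col X (Rep p j) \<longleftrightarrow> rep (E j) (pt q) b" if "j < n" for j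
      using col_Rep[OF assms(2,1) that \<open>b \<in> pt q\<close>] by (simp only: sep_swap[of V "adj G" "pt q"])
    show "a \<in> col X (Lab q i j) \<longleftrightarrow> lab (pt q) i j a" if "j < n" for j
      using col_Lab[OF assms(1,2,3) that \<open>a \<in> pt p\<close>] by (simp only: lab_def)
    show "b \<in> col X (Lab p i j) \<longleftrightarrow> lab (pt p) i j b" if "j < n" for j
      using col_Lab[OF assms(2,1,3) that \<open>b \<in> pt q\<close>]
      by (simp only: lab_def sep_swap[of V "adj G" "pt q"])
  qed (fact that)+
  have "decoded n H p q i u v \<longleftrightarrow> (\<exists>a\<in>pt p. \<exists>b\<in>pt q. col_near n H p q i u b \<and>
      col_near n H p q i a b \<and> col_near n H p q i a v)"
    unfolding decoded_def H_simps col_Part[OF assms(1)] col_Part[OF assms(2)]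
    using part_subset by blast
  also have "\<dots> \<longleftrightarrow> E i u v"
    using E_decode[OF assms(4,5,3) near] by simp
  finally show ?thesis .
qed

lemma decoded_adj_H:
  assumes "u \<in> V" "v \<in> V" "u \<noteq> v"
  shows "decoded_adj N k H u v \<longleftrightarrow> adj G u v"
proof -
  obtain p where p: "p < N" "u \<in> pt p" using cover[OF assms(1)] .
  obtain q where q: "q < N" "v \<in> pt q" using cover[OF assms(2)] .
  note pq = p q
  interpret ordered_layered_pair V "adj G" "pt p" "pt q" k by (rule pair)
  have "decoded_adj N k H u v \<longleftrightarrow> (\<exists>p<N. u \<in> pt p \<and> (\<exists>q<N. v \<in> pt q \<and> (\<exists>i<2 * k. odd i \<and>
      decoded n H p q i u v \<and> \<not> decoded n H p q (Suc i) u v)))"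
    unfolding decoded_adj_def H_simps using col_Part by auto
  also have "\<dots> \<longleftrightarrow> (\<exists>i<2 * k. odd i \<and> decoded n H p q i u v \<and> \<not> decoded n H p q (Suc i) u v)"
    unfolding ex_part[OF pq(1,2)] ex_part[OF pq(3,4)] ..
  also have "\<dots> \<longleftrightarrow> (\<exists>i<2 * k. odd i \<and> E i u v \<and> \<not> E (Suc i) u v)"
    using decoded_H[OF pq(1,3) _ pq(2,4)] by auto
  also have "\<dots> \<longleftrightarrow> adj G u v"
    using adj_iff[of u v] pq assms(3) by (simp add: cross_def)
  finally show ?thesis .
qed

text \<open>Interpretations keep vertices and predicates, so recovering adjacency recovers the
  entire colored graph.\<close>

lemma interp_H: "interp \<psi> H = X"
proof -
  have "(u \<in> V \<and> v \<in> V \<and> u \<noteq> v \<and> (holds2 H \<psi> u v \<or> holds2 H \<psi> v u)) \<longleftrightarrow> adj G u v" for u v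
  proof (cases "u \<in> V \<and> v \<in> V \<and> u \<noteq> v")
    case True
    then have "holds2 H \<psi> u v \<longleftrightarrow> adj G u v" "holds2 H \<psi> v u \<longleftrightarrow> adj G v u"
      using decoded_adj_H by (simp_all add: \<psi> H_simps)
    then show ?thesis using True simple unfolding simple_graph_def by blast
  qed (use simple in \<open>auto simp: simple_graph_def\<close>)
  then have "interp \<psi> H = H\<lparr>adj := adj G\<rparr>"
    unfolding interp_def[of \<psi>] H_simps by (intro arg_cong[where f = "\<lambda>a. adj_update (\<lambda>_. a) H"] ext)
  then show ?thesis by (simp add: interp_def colored_def)
qed

end

theorem theorem6p3:
  fixes N k :: nat
  shows "\<exists>(d :: nat) (m :: nat) (\<kappa> :: nat graph \<Rightarrow> nat set set \<Rightarrow> nat \<Rightarrow> nat set)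
            (D :: nat cgraph set) (\<phi> :: fm) (\<psi> :: fm).
     (\<forall>G \<in> cosplit_class N k. \<forall>P. bounded_cosplit N k G P \<longrightarrow> coloring m G (\<kappa> G P)) \<and>
     (\<forall>H \<in> D. colored_graph m H \<and> degenerate d H) \<and>
     poly_time_coloring {(G, P). G \<in> cosplit_class N k \<and> bounded_cosplit N k G P} m \<kappa> \<and>
     simple_equivalence \<phi> \<psi>
       {colored G (\<kappa> G P) | G P. G \<in> cosplit_class N k \<and> bounded_cosplit N k G P} D"
proof -
  let ?n = "Suc (2 * k)"
  have "fo.D2 (linked N ?n :: nat cgraph \<Rightarrow> _)" by (rule fo_linked)
  then obtain \<phi> where \<phi>: "binary_fm \<phi>"
    "\<And>(G :: nat cgraph) u v. u \<in> verts G \<Longrightarrow> v \<in> verts G \<Longrightarrow> holds2 G \<phi> u v = linked N ?n G u v"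
    by (rule fo_D2_formula) blast
  have "fo.D2 (decoded_adj N k :: nat cgraph \<Rightarrow> _)" by (rule fo_decoded_adj)
  then obtain \<psi> where \<psi>: "binary_fm \<psi>"
    "\<And>(G :: nat cgraph) u v. u \<in> verts G \<Longrightarrow> v \<in> verts G \<Longrightarrow> holds2 G \<psi> u v = decoded_adj N k G u v"
    by (rule fo_D2_formula) blast
  \<comment> \<open>All colors that the formulas can mention; there are finitely many, so one
    \<open>M\<close> bounds their indices independently of the graph.\<close>
  let ?C = "Part ` {..<N} \<union> case_prod Rep ` ({..<N} \<times> {..<?n}) \<union>
    (\<lambda>(q, i, j). Lab q i j) ` ({..<N} \<times> {..<?n} \<times> {..<?n})"
  have "finite (to_nat ` ?C)"
    by (intro finite_imageI finite_UnI finite_cartesian_product finite_lessThan)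
  then obtain M where "\<forall>x\<in>to_nat ` ?C. x < M"
    unfolding finite_nat_set_iff_bounded by (rule exE)
  then have bound: "to_nat c < M" if "c \<in> ?C" for c using imageI[OF that] by (rule bspec)
  have M: "\<And>p. p < N \<Longrightarrow> to_nat (Part p) < M"
      "\<And>q i. q < N \<Longrightarrow> i \<le> 2 * k \<Longrightarrow> to_nat (Rep q i) < M"
      "\<And>q i j. q < N \<Longrightarrow> i \<le> 2 * k \<Longrightarrow> j \<le> 2 * k \<Longrightarrow> to_nat (Lab q i j) < M"
    by (rule bound, force)+
  let ?I = "{(G, P). G \<in> cosplit_class N k \<and> bounded_cosplit N k G P}"
  let ?\<kappa> = "cosplit_coloring M N"
  let ?C' = "{colored G (?\<kappa> G P) | G P. G \<in> cosplit_class N k \<and> bounded_cosplit N k G P}"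
  \<comment> \<open>Taking the image makes the map surjective by definition; injectivity follows
    because \<open>\<psi>\<close> gives a left inverse.\<close>
  let ?D = "interp \<phi> ` ?C'"
  have valid: "cosplit_graph_interp N k M G P \<phi> \<psi>"
    if "G \<in> cosplit_class N k" "bounded_cosplit N k G P" for G P
    by unfold_locales (use that \<phi>(2) \<psi>(2) M in \<open>simp_all add: cosplit_class_def\<close>)
  have coloring: "coloring M G (?\<kappa> G P)" for G P
    by (simp add: coloring_def cosplit_coloring_def)
  have inverse: "interp \<psi> (interp \<phi> Y) = Y" if Y: "Y \<in> ?C'" for Y
  proof -
    obtain G P where GP: "G \<in> cosplit_class N k" "bounded_cosplit N k G P" "Y = colored G (?\<kappa> G P)"
      using Y by blast
    from cosplit_graph_interp.interp_H[OF valid[OF GP(1,2)]] show ?thesis by (simp only: GP(3))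
  qed
  have D: "colored_graph M H \<and> degenerate (2 * (N * ?n)) H" if H: "H \<in> ?D" for H
  proof -
    obtain G P where GP: "G \<in> cosplit_class N k" "bounded_cosplit N k G P"
      "H = interp \<phi> (colored G (?\<kappa> G P))" using H by blast
    interpret cosplit_graph_interp N k M G P \<phi> \<psi> using GP(1,2) by (rule valid)
    have "coloring M H (upred H)"
      using coloring[of G P] unfolding coloring_def GP(3) H_simps by (simp add: colored_def)
    then show ?thesis unfolding colored_graph_def using simple_H degenerate_H GP(3) by simp
  qed
  have poly: "poly_time_coloring ?I M ?\<kappa>"
    unfolding cosplit_coloring_def[abs_def]
    by (rule poly_time_coloring_queries[OF pt_has_colour])
      (auto simp: cosplit_class_def simple_graph_def)
  have inj: "inj_on (interp \<phi>) ?C'"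
    using inverse by (rule inj_on_inverseI)
  have equiv: "simple_equivalence \<phi> \<psi> ?C' ?D"
    unfolding simple_equivalence_def
  proof (intro conjI ballI)
    fix H assume "H \<in> ?D"
    then obtain Y where Y: "Y \<in> ?C'" "H = interp \<phi> Y" by (rule imageE)
    then show "interp \<psi> H = inv_into ?C' (interp \<phi>) H"
      using inverse[OF Y(1)] inv_into_f_f[OF inj Y(1)] by simp
  qed (use \<phi>(1) \<psi>(1) inj in \<open>simp_all add: bij_betw_def\<close>)
  show ?thesis
  proof (rule exI[of _ "2 * (N * ?n)"], rule exI[of _ M], rule exI[of _ ?\<kappa>], rule exI[of _ ?D],
      rule exI[of _ \<phi>], rule exI[of _ \<psi>], intro conjI ballI allI impI)
    show "coloring M G (?\<kappa> G P)" for G P by (rule coloring)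
    show "colored_graph M H" "degenerate (2 * (N * ?n)) H" if "H \<in> ?D" for H
      using D[OF that] by simp_all
  qed (fact poly, fact equiv)
qed

end
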